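(* Let $a\approx1.306$ be the root in $(0,\pi/2)$ of $\cos(a)+\sin(a)/a-1=0$ and $\alpha=1-\cos(a)\approx0.7388$. For every $\epsilon>0$ and every set $\mathbb{X}$ of $n$ items there exists a number $c_\epsilon$ (a function of $\epsilon$ only, independent of $n$) such that if $\mathbb{X}$ is $m$-frequent for some $m\ge c_\epsilon\log(n)$, then there exists an online algorithm which, when the items are revealed in a uniformly random order, is in expectation a $(1-\epsilon)\alpha$-approximation, i.e. its expected accepted value (over the random order and the values) is at least $(1-\epsilon)\alpha\,\mathbb{E}[\max_{X\in\mathbb{X}}X]$.
   Context: An item is a nonnegative random variable $X_i$ with distribution function $F_i$ (continuous and strictly increasing on a subinterval of $\mathbb{R}_{\ge0}$); the items are independent and the distributions are known to the algorithm. In an online algorithm the values are revealed one by one in some order, and on seeing a value the algorithm must irrevocably accept it (and stop) or reject it; the algorithm's value is the accepted value ($0$ if none). A set of $n$ items is $m$-frequent if for every item $i$ there are at least $m-1$ other items in the set with the same distribution function as $F_i$. *)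

theory Defs
  imports "HOL-Probability.Probability" "HOL-Combinatorics.Permutations"
begin

text \<open>
  An item is given by its law \<open>D\<close> on the reals, with distribution function \<open>cdf D\<close>.
  The interval \<open>J\<close> carries all of the mass, so the item is nonnegative almost surely.
\<close>

definition item_dist :: "real measure \<Rightarrow> bool" where
  "item_dist D \<longleftrightarrow> real_distribution D \<and>
     (\<exists>J. is_interval J \<and> interior J \<noteq> {} \<and> J \<subseteq> {0..} \<and> measure D J = 1 \<and>
          continuous_on J (cdf D) \<and> strict_mono_on J (cdf D))"

definition frequent :: "nat \<Rightarrow> nat \<Rightarrow> (nat \<Rightarrow> real measure) \<Rightarrow> bool" where
  "frequent m n D \<longleftrightarrow>
     (\<forall>i<n. m - 1 \<le> card {j. j < n \<and> j \<noteq> i \<and> cdf (D j) = cdf (D i)})"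

text \<open>
  \<open>A t h\<close> is the decision to accept at time \<open>t\<close> (times start at 0), where the history
  \<open>h\<close> lists the values revealed at times \<open>0, \<dots>, t\<close>.
\<close>

definition online_algorithm :: "(nat \<Rightarrow> (nat \<Rightarrow> real) \<Rightarrow> bool) \<Rightarrow> bool" where
  "online_algorithm A \<longleftrightarrow> (\<forall>t. Measurable.pred (Pi\<^sub>M {..t} (\<lambda>_. borel)) (A t))"

definition accepted_value ::
    "(nat \<Rightarrow> (nat \<Rightarrow> real) \<Rightarrow> bool) \<Rightarrow> nat \<Rightarrow> (nat \<Rightarrow> real) \<Rightarrow> real" where
  "accepted_value A n v =
     (if \<exists>t<n. A t (restrict v {..t}) then v (LEAST t. A t (restrict v {..t})) else 0)"

text \<open>
  Expectations of nonnegative quantities are taken in \<open>[0, \<infinity>]\<close>. Independence of the items is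
  expressed by the product measure; the order \<open>\<sigma>\<close> reveals item \<open>\<sigma> t\<close> at time \<open>t\<close>.
\<close>

definition random_order_value ::
    "(nat \<Rightarrow> (nat \<Rightarrow> real) \<Rightarrow> bool) \<Rightarrow> nat \<Rightarrow> (nat \<Rightarrow> real measure) \<Rightarrow> ennreal" where
  "random_order_value A n D =
     (\<integral>\<^sup>+\<sigma>. (\<integral>\<^sup>+x. ennreal (accepted_value A n (\<lambda>t. x (\<sigma> t))) \<partial>(Pi\<^sub>M {..<n} D))
        \<partial>measure_pmf (pmf_of_set {\<sigma>. \<sigma> permutes {..<n}}))"

definition expected_max :: "nat \<Rightarrow> (nat \<Rightarrow> real measure) \<Rightarrow> ennreal" where
  "expected_max n D = (\<integral>\<^sup>+x. ennreal (Max (x ` {..<n})) \<partial>(Pi\<^sub>M {..<n} D))"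

end

theory Submission
  imports Defs
begin

text \<open>
  Cut the time line into \<open>K\<close> phases of equal length. By a Chernoff bound for sampling without
  replacement and \<open>m \<ge> c ln n\<close>, with high probability every class of identically distributed items
  is spread almost evenly over the phases. For such an order and any level \<open>y\<close>, the product of the
  distribution functions over the items of one phase is nearly \<open>F y powr (1 / K)\<close>, where \<open>F\<close> is the
  distribution function of the maximum. Using in phase \<open>i\<close> a threshold \<open>\<theta> i\<close> with
  \<open>- ln (F (\<theta> i)) = K ln (cos (a i / K) / cos (a (i + 1) / K))\<close>, the algorithm survives \<open>s\<close> phases
  with probability about \<open>cos (a s / K)\<close>, so that for a value \<open>x\<close> between the thresholds of phases
  \<open>s - 1\<close> and \<open>s\<close>, with \<open>\<phi> = a s / K\<close> and \<open>u = - ln (F x) / a\<close>, it accepts something above \<open>x\<close>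
  with probability about \<open>1 - cos \<phi> + u (sin a - sin \<phi>)\<close>. This is at least
  \<open>1 + u sin a - sqrt (1 + u\<^sup>2)\<close>, which for the given root \<open>a\<close> dominates
  \<open>(1 - cos a) (1 - exp (- a u)) = \<alpha> (1 - F x)\<close>; integrating over \<open>x\<close> gives the claim.

  The distribution of the maximum may have an atom at the left end \<open>l\<close> of its support, where no
  threshold attains a prescribed level. The last phase therefore accepts everything \<open>\<ge> l\<close>, which
  costs only \<open>O(1/K)\<close> and makes all \<open>x < l\<close> trivial.
\<close>

section \<open>The analytic inequality at the root\<close>

text \<open>Below \<open>13 / 10\<close> the left side of the root equation is still positive:
  Maclaurin lower bounds for \<open>cos a\<close> and \<open>sin a / a\<close> reduce this to a
  polynomial in \<open>b = a^2\<close> that is positive up to \<open>169 / 100\<close>. The root is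
  about 1.306, so there is little room.\<close>

lemma root_ge_13:
  fixes a :: real
  assumes "0 < a" and "cos a + sin a / a - 1 = 0"
  shows "13 / 10 \<le> a"
proof (rule ccontr)
  assume "\<not> 13 / 10 \<le> a"
  hence a: "a < 13 / 10" by simp
  obtain t where t: "cos a = (\<Sum>m<8. cos_coeff m * a ^ m) + cos (t + 1/2 * real (8::nat) * pi) / fact 8 * a ^ 8"
    using Maclaurin_cos_expansion[of a 8] by blast
  have "\<bar>cos (t + 1/2 * real (8::nat) * pi) / fact 8 * a ^ 8\<bar> \<le> 1 / fact 8 * a ^ 8"
    unfolding abs_mult abs_divide using assms(1)
    by (intro mult_mono divide_right_mono) (auto simp: divide_le_cancel)
  moreover have idx: "{..<8::nat} = {0,1,2,3,4,5,6,7}" by auto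
  ultimately have c: "cos a \<ge> 1 - a^2/2 + a^4/24 - a^6/720 - a^8/40320"
    unfolding t idx by (simp add: cos_coeff_def fact_numeral)
  have "\<bar>sin a - (\<Sum>m<8. sin_coeff m * a ^ m)\<bar> \<le> inverse (fact 8) * \<bar>a\<bar> ^ 8"
    by (rule Maclaurin_sin_bound)
  hence "(\<Sum>m<8. sin_coeff m * a ^ m) - inverse (fact 8) * a ^ 8 \<le> sin a"
    using assms(1) by (auto simp: abs_le_iff)
  hence s: "sin a \<ge> a - a^3/6 + a^5/120 - a^7/5040 - a^8/40320"
    using assms(1) unfolding idx by (simp add: sin_coeff_def fact_numeral abs_le_iff)
  have "sin a / a \<ge> (a - a^3/6 + a^5/120 - a^7/5040 - a^8/40320) / a"
    using s assms(1) by (intro divide_right_mono) auto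
  also have "(a - a^3/6 + a^5/120 - a^7/5040 - a^8/40320) / a = 1 - a^2/6 + a^4/120 - a^6/5040 - a^7/40320"
    using assms(1) by (simp add: field_simps eval_nat_numeral)
  finally have "0 \<ge> 1 - 2*a^2/3 + a^4/20 - a^6/630 - a^8/40320 - a^7/40320"
    using c assms(2) by argo
  moreover define b where "b = a^2"
  have b: "0 \<le> b" "b \<le> 169/100"
    using a assms(1) power_mono[of a "13/10" 2] unfolding b_def by (auto simp: power2_eq_square)
  moreover have "a^4 = b^2" "a^6 = b^3" "a^8 = b^3 * b" "a^7 = b^3 * a"
    unfolding b_def by (simp_all add: eval_nat_numeral)
  \<comment> \<open>The highest terms are absorbed into \<open>b^3\<close>, using
    \<open>a \<le> 2\<close> and \<open>b \<le> 2\<close>; together they give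
    \<open>4 / 40320 = 1 / 10080\<close>.\<close>
  moreover have "b^3 * b \<le> b^3 * 2" "b^3 * a \<le> b^3 * 2"
    using b a by (auto intro!: mult_left_mono)
  ultimately have *: "0 \<ge> 1 - 2*b/3 + b^2/20 - b^3/630 - b^3/10080"
    unfolding b_def[symmetric] by simp
  have "b^3 \<le> b^2 * (169/100)"
    using b mult_left_mono[of b "169/100" "b^2"] by (simp add: eval_nat_numeral mult.assoc)
  moreover have "0 \<le> b^2" by simp
  ultimately have "0 \<ge> 1 - 2*b/3 + 47/1000 * b^2" using * by linarith
  \<comment> \<open>The tangent of the square at \<open>b = 169 / 100\<close> leaves a linear
    inequality in \<open>b\<close>.\<close>
  moreover have "b^2 \<ge> 338/100*b - 28561/10000"
    using zero_le_power2[of "b - 169/100"] by (simp add: power2_diff power_divide)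
  ultimately show False using b(2) by linarith
qed

section \<open>Rational bounds for \<open>exp\<close> and convexity of the square-root term\<close>

lemma exp_neg_quarter_ge: "(1947/2500::real) ^ j \<le> exp (- (real j / 4))"
proof -
  \<comment> \<open>\<open>1947 / 2500 = 0.7788\<close> is \<open>exp (-1/4)\<close> rounded down;
    it is verified through its fourth power and an upper bound for \<open>e\<close>.\<close>
  have "(1947/2500::real) \<le> exp (-1/4)"
  proof (rule ccontr)
    assume "\<not> (1947/2500::real) \<le> exp (-1/4)"
    hence "exp (-1/4) ^ 4 < (1947/2500::real) ^ 4" by (intro power_strict_mono) auto
    moreover have "exp (-1/4::real) ^ 4 = exp (-1)" by (simp flip: exp_of_nat_mult)
    moreover have "(1::real) / 2.71829 \<le> 1 / exp 1"
      using e_approx_32 by (intro divide_left_mono) (simp_all add: abs_if split: if_splits)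
    ultimately show False by (simp add: exp_minus divide_simps power_divide)
  qed
  hence "(1947/2500::real) ^ j \<le> exp (-1/4) ^ j" by (intro power_mono) auto
  thus ?thesis by (simp flip: exp_of_nat_mult)
qed

text \<open>The tangent of \<open>exp (- z)\<close> at \<open>c\<close> with its factor
  \<open>exp (- c)\<close> lowered to \<open>p\<close>. This lowers the line where it is positive;
  elsewhere the line is at most 0 anyway.\<close>

lemma exp_neg_ge_tangent:
  fixes z c p :: real
  assumes "0 \<le> p" "p \<le> exp (- c)"
  shows "p * (1 - (z - c)) \<le> exp (- z)"
proof (cases "1 - (z - c) \<ge> 0")
  case True
  have "p * (1 - (z - c)) \<le> exp (- c) * exp (- (z - c))"
    using assms True exp_ge_add_one_self[of "- (z - c)"] by (intro mult_mono) (auto simp: algebra_simps)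
  also have "\<dots> = exp (- z)" by (simp flip: exp_add)
  finally show ?thesis .
next
  case False
  hence "p * (1 - (z - c)) \<le> 0" using assms by (intro mult_nonneg_nonpos) auto
  thus ?thesis by (smt (verit) exp_gt_zero)
qed

text \<open>The root is the Euclidean norm of \<open>(1, z / sqrt b)\<close>, which depends affinely
  on \<open>z\<close>; the triangle inequality therefore gives convexity.\<close>

lemma sqrt_le_affine_on_interval:
  fixes z z0 z1 p q b :: real
  assumes "z0 \<le> z" "z \<le> z1" "0 < b"
    and e0: "sqrt (1 + z0\<^sup>2 / b) \<le> p * z0 + q" and e1: "sqrt (1 + z1\<^sup>2 / b) \<le> p * z1 + q"
  shows "sqrt (1 + z\<^sup>2 / b) \<le> p * z + q"
proof (cases "z0 = z1")
  case True
  thus ?thesis using assms by auto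
next
  case False
  hence lt: "z0 < z1" using assms by simp
  define t where "t = (z - z0) / (z1 - z0)"
  have t: "0 \<le> t" "t \<le> 1" using assms lt by (auto simp: t_def field_simps)
  have "t * (z1 - z0) = z - z0" using lt by (simp add: t_def)
  hence z: "z = (1 - t) * z0 + t * z1" by (simp add: algebra_simps)
  have nrm: "norm (1::real, x / sqrt b) = sqrt (1 + x\<^sup>2 / b)" for x
    using \<open>0 < b\<close> by (simp add: norm_Pair power_divide)
  have "(1::real, z / sqrt b) = (1 - t) *\<^sub>R (1, z0 / sqrt b) + t *\<^sub>R (1, z1 / sqrt b)"
    by (simp add: z add_divide_distrib)
  hence "norm (1::real, z / sqrt b) \<le> (1 - t) * norm (1::real, z0 / sqrt b) + t * norm (1::real, z1 / sqrt b)"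
    using t by (metis (no_types, lifting) abs_of_nonneg diff_ge_0_iff_ge norm_scaleR norm_triangle_ineq)
  also have "\<dots> \<le> (1 - t) * (p * z0 + q) + t * (p * z1 + q)"
    unfolding nrm using e0 e1 t by (intro add_mono mult_left_mono) auto
  also have "\<dots> = p * z + q" by (simp add: z algebra_simps)
  finally show ?thesis unfolding nrm .
qed

text \<open>On each piece \<open>exp\<close> is replaced by a line below its tangent at \<open>j / 4\<close>, and a convex function
  below an affine one need only be checked at the end points.\<close>

lemma exp_ge_sqrt_piece:
  fixes z z0 z1 p :: real and j :: nat
  assumes "z0 \<le> z" "z \<le> z1" and p: "0 \<le> p" "p \<le> (1947/2500) ^ j"
    and e0: "0 \<le> 1 + (p * (1 - (z0 - real j / 4)) - 1 + z0) * (200/269)"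
      "1 + z0\<^sup>2 / (169/100) \<le> (1 + (p * (1 - (z0 - real j / 4)) - 1 + z0) * (200/269))\<^sup>2"
    and e1: "0 \<le> 1 + (p * (1 - (z1 - real j / 4)) - 1 + z1) * (200/269)"
      "1 + z1\<^sup>2 / (169/100) \<le> (1 + (p * (1 - (z1 - real j / 4)) - 1 + z1) * (200/269))\<^sup>2"
  shows "269/200 * (sqrt (1 + z\<^sup>2 / (169/100)) - 1) \<le> exp (- z) - 1 + z"
proof -
  have aff: "1 + (p * (1 - (x - c)) - 1 + x) * k = (1 - p) * k * x + (1 + (p * (1 + c) - 1) * k)"
    for c k x :: real by algebra
  note lin = aff[of _ "real j / 4" "200/269"]
  have "sqrt (1 + z\<^sup>2 / (169/100)) \<le> (1 - p) * (200/269) * z + (1 + (p * (1 + real j / 4) - 1) * (200/269))"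
    using real_le_lsqrt[OF e0] real_le_lsqrt[OF e1] unfolding lin
    by (rule sqrt_le_affine_on_interval[OF assms(1,2), rotated]) simp
  also have "\<dots> \<le> 1 + (exp (- z) - 1 + z) * (200/269)"
    unfolding lin[symmetric]
    using exp_neg_ge_tangent[OF p(1) order_trans[OF p(2) exp_neg_quarter_ge], of z] by simp
  finally have "269/200 * (sqrt (1 + z\<^sup>2 / (169/100)) - 1) \<le> 269/200 * ((exp (- z) - 1 + z) * (200/269))"
    by (intro mult_left_mono) linarith+
  thus ?thesis by simp
qed

text \<open>The case \<open>b = 169 / 100\<close> of the inequality: \<open>269 / 200\<close> is
  \<open>(b + 1) / 2\<close>, and \<open>49 / 10\<close> lies just above
  \<open>2 b / (b - 1)\<close>. Both sides vanish to second order at 0, so the first piece needs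
  Taylor bounds; away from 0 tangent lines suffice.\<close>

lemma exp_ge_sqrt_169:
  fixes z :: real
  assumes "0 \<le> z" "z \<le> 49/10"
  shows "269/200 * (sqrt (1 + z\<^sup>2 / (169/100)) - 1) \<le> exp (- z) - 1 + z"
proof -
  \<comment> \<open>From the second piece on, the tangent point \<open>j / 4\<close> lies in the
    piece and \<open>p\<close> is \<open>(1947 / 2500) ^ j\<close> rounded down.\<close>
  consider "z \<le> 6/10" | "6/10 \<le> z" "z \<le> 1" | "1 \<le> z" "z \<le> 157/100"
    | "157/100 \<le> z" "z \<le> 21/10" | "21/10 \<le> z" "z \<le> 3" | "3 \<le> z" "z \<le> 37/10"
    | "37/10 \<le> z" "z \<le> 49/10"
    using assms by linarith
  thus ?thesis
  proof cases
    case 1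
    have "sqrt (1 + z\<^sup>2 / (169/100)) \<le> 1 + z\<^sup>2 * (50/169)"
      by (rule real_le_lsqrt) (simp_all add: power2_sum field_simps)
    moreover have "z\<^sup>2 * z \<le> z\<^sup>2 * (6/10)" using 1 by (intro mult_left_mono) auto
    moreover have "0 \<le> z\<^sup>2" by simp
    moreover have "exp (- z) \<ge> 1 - z + z\<^sup>2 / 2 - z\<^sup>2 * z / 6"
    proof -
      \<comment> \<open>The remainder of the cubic expansion is nonnegative because the fourth power
        is even.\<close>
      obtain t where "exp (- z) = (\<Sum>m<4. (- z) ^ m / fact m) + exp t / fact 4 * (- z) ^ 4"
        using Maclaurin_exp_le[of "- z" 4] by blast
      moreover have "{..<4::nat} = {0,1,2,3}" by auto
      moreover have "0 \<le> exp t / fact 4 * (- z) ^ 4" by simp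
      ultimately show ?thesis by (simp add: fact_numeral power3_eq_cube power2_eq_square)
    qed
    moreover have "269/200 * (S - 1) \<le> e - 1 + z"
      if "S \<le> 1 + q * (50/169)" "t \<le> q * (6/10)" "0 \<le> q" "1 - z + q / 2 - t / 6 \<le> e"
      for S q t e :: real using that by (simp add: field_simps)
    ultimately show ?thesis by blast
  next
    case 2
    thus ?thesis
      by (rule exp_ge_sqrt_piece[where j = 3 and p = "59/125"]) (simp_all add: power_divide power2_eq_square)
  next
    case 3
    thus ?thesis
      by (rule exp_ge_sqrt_piece[where j = 5 and p = "179/625"]) (simp_all add: power_divide power2_eq_square)
  next
    case 4
    thus ?thesis
      by (rule exp_ge_sqrt_piece[where j = 7 and p = "1737/10000"]) (simp_all add: power_divide power2_eq_square)
  next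
    case 5
    thus ?thesis
      by (rule exp_ge_sqrt_piece[where j = 10 and p = "41/500"]) (simp_all add: power_divide power2_eq_square)
  next
    case 6
    thus ?thesis
      by (rule exp_ge_sqrt_piece[where j = 12 and p = "497/10000"]) (simp_all add: power_divide power2_eq_square)
  next
    case 7
    thus ?thesis
      by (rule exp_ge_sqrt_piece[where j = 16 and p = "183/10000"]) (simp_all add: power_divide power2_eq_square)
  qed
qed

text \<open>Writing \<open>b = a\<^sup>2\<close> and \<open>z = a u\<close>, the root equation turns the final inequality into
  \<open>(b + 1) / 2 * (sqrt (1 + z\<^sup>2 / b) - 1) \<le> exp (- z) - 1 + z\<close> for \<open>0 \<le> z \<le> 2 b / (b - 1)\<close>. On that
  range the left side decreases in \<open>b\<close>, so the lower bound \<open>b \<ge> 1.69\<close> suffices.\<close>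

lemma sqrt_term_antimono:
  fixes b c z :: real
  assumes "1 < c" "c \<le> b" "0 \<le> z" "z \<le> 2 * b / (b - 1)"
  shows "(b + 1) / 2 * (sqrt (1 + z\<^sup>2 / b) - 1) \<le> (c + 1) / 2 * (sqrt (1 + z\<^sup>2 / c) - 1)"
proof (rule DERIV_nonpos_imp_nonincreasing[of c b "\<lambda>b. (b + 1) / 2 * (sqrt (1 + z\<^sup>2 / b) - 1)", OF assms(2)])
  fix x assume x: "c \<le> x" "x \<le> b"
  define r where "r = sqrt (1 + z\<^sup>2 / x)"
  have x1: "x > 1" using x assms by simp
  have r1: "r \<ge> 1" using x1 by (simp add: r_def)
  have r2: "r\<^sup>2 = 1 + z\<^sup>2 / x" using x1 by (simp add: r_def add_nonneg_nonneg)
  have "((\<lambda>b. (b + 1) / 2 * (sqrt (1 + z\<^sup>2 / b) - 1)) has_real_derivative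
      ((r - 1) / 2 - (x + 1) / 4 * (z\<^sup>2 / x\<^sup>2) / r)) (at x)"
  proof -
    have "((\<lambda>b. 1 + z\<^sup>2 / b) has_real_derivative - (z\<^sup>2 / x\<^sup>2)) (at x)"
      using x1 by (auto intro!: derivative_eq_intros simp: power2_eq_square)
    from DERIV_chain2[OF DERIV_real_sqrt this]
    have d1: "((\<lambda>b. sqrt (1 + z\<^sup>2 / b)) has_real_derivative inverse r / 2 * - (z\<^sup>2 / x\<^sup>2)) (at x)"
      using x1 by (simp add: r_def add_pos_nonneg)
    have d2: "((\<lambda>b. (b + 1) / 2) has_real_derivative 1/2) (at x)"
      by (auto intro!: derivative_eq_intros)
    from DERIV_mult[OF d2 DERIV_diff[OF d1 DERIV_const[of 1]]]
    have "((\<lambda>b. (b + 1) / 2 * (sqrt (1 + z\<^sup>2 / b) - 1)) has_real_derivative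
      1/2 * (r - 1) + (inverse r / 2 * - (z\<^sup>2 / x\<^sup>2) - 0) * ((x + 1) / 2)) (at x)"
      by (simp only: r_def)
    moreover have "1/2 * (r - 1) + (inverse r / 2 * - (z\<^sup>2 / x\<^sup>2) - 0) * ((x + 1) / 2) =
      (r - 1) / 2 - (x + 1) / 4 * (z\<^sup>2 / x\<^sup>2) / r"
      by (simp add: inverse_eq_divide diff_divide_distrib mult.commute)
    ultimately show ?thesis by simp
  qed
  \<comment> \<open>The derivative has the sign of \<open>(r - 1) * (r * (x - 1) - (x + 1))\<close>.
    At \<open>z = 2 x / (x - 1)\<close> the value of \<open>r\<close> is exactly
    \<open>(x + 1) / (x - 1)\<close>, and the bound on \<open>z\<close> only gets weaker when
    \<open>b\<close> is lowered to \<open>x\<close>.\<close>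
  moreover have "(r - 1) / 2 - (x + 1) / 4 * (z\<^sup>2 / x\<^sup>2) / r \<le> 0"
  proof -
    have "2 * b / (b - 1) \<le> 2 * x / (x - 1)" using x x1 by (simp add: field_simps)
    hence "z\<^sup>2 \<le> (2 * x / (x - 1))\<^sup>2" using assms by (intro power_mono) auto
    hence "r\<^sup>2 \<le> 1 + (2 * x / (x - 1))\<^sup>2 / x" unfolding r2 using x1 by (simp add: divide_right_mono)
    also have "(2 * x / (x - 1))\<^sup>2 / x = 4 * x / (x - 1)\<^sup>2"
      using x1 by (simp add: power_divide power2_eq_square)
    also have "1 + 4 * x / (x - 1)\<^sup>2 = ((x - 1)\<^sup>2 + 4 * x) / (x - 1)\<^sup>2"
      using x1 by (simp add: add_divide_distrib)
    also have "(x - 1)\<^sup>2 + 4 * x = (x + 1)\<^sup>2" by (simp add: power2_eq_square algebra_simps)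
    also have "(x + 1)\<^sup>2 / (x - 1)\<^sup>2 = ((x + 1) / (x - 1))\<^sup>2" by (simp add: power_divide)
    finally have "r \<le> (x + 1) / (x - 1)" using x1 by (rule_tac power2_le_imp_le) simp_all
    hence "r * (x - 1) \<le> x + 1" using x1 by (simp add: pos_le_divide_eq)
    hence "(r - 1) * (r * (x - 1)) \<le> (r - 1) * (x + 1)" using r1 by (intro mult_left_mono) auto
    hence "2 * x * r * (r - 1) \<le> (x + 1) * (r\<^sup>2 - 1)" by (simp add: algebra_simps power2_eq_square)
    hence "(2 * x * r * (r - 1) - (x + 1) * (r\<^sup>2 - 1)) / (4 * x * r) \<le> 0"
      using x1 r1 by (intro divide_nonpos_pos) auto
    moreover have "(x + 1) / 4 * (z\<^sup>2 / x\<^sup>2) / r = (x + 1) * (r\<^sup>2 - 1) / (4 * x * r)"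
      using r2 x1 by (simp add: power2_eq_square)
    moreover have "(r - 1) / 2 = 2 * x * r * (r - 1) / (4 * x * r)" using x1 r1 by simp
    ultimately show ?thesis by (simp only: diff_divide_distrib)
  qed
  ultimately show "\<exists>y. ((\<lambda>b. (b + 1) / 2 * (sqrt (1 + z\<^sup>2 / b) - 1)) has_real_derivative y) (at x) \<and> y \<le> 0"
    by blast
qed

text \<open>Inserting the root equation into \<open>sin^2 + cos^2 = 1\<close> gives a quadratic in
  \<open>cos a\<close>; the solution \<open>cos a = 1\<close> is divided out.\<close>

lemma root_sin_cos:
  fixes a :: real
  assumes "0 < a" "a < pi / 2" "cos a + sin a / a - 1 = 0"
  shows "sin a = a * (1 - cos a)" "cos a = (a\<^sup>2 - 1) / (a\<^sup>2 + 1)"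
proof -
  show s: "sin a = a * (1 - cos a)" using assms by (simp add: field_simps)
  have "cos a < cos 0" using assms by (intro cos_monotone_0_pi) auto
  hence "cos a \<noteq> 1" by simp
  moreover have "(a * (1 - cos a))\<^sup>2 + (cos a)\<^sup>2 = 1" using s sin_cos_squared_add[of a] by simp
  hence "(1 - cos a) * (a\<^sup>2 * (1 - cos a) - (1 + cos a)) = 0"
    by (simp add: power_mult_distrib algebra_simps power2_eq_square)
  ultimately have "a\<^sup>2 * (1 - cos a) = 1 + cos a" by simp
  hence "cos a * (a\<^sup>2 + 1) = a\<^sup>2 - 1" by (simp add: algebra_simps)
  thus "cos a = (a\<^sup>2 - 1) / (a\<^sup>2 + 1)" by (simp add: field_simps add_nonneg_eq_0_iff)
qed

text \<open>Since \<open>1 - cos a = 2 / (b + 1)\<close>, dividing by it leaves the inequality in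
  \<open>z\<close> and \<open>b\<close>, and \<open>u \<le> tan a\<close> turns into
  \<open>z \<le> 2 b / (b - 1)\<close>, the range in which lowering \<open>b\<close> to
  \<open>169 / 100\<close> is allowed.\<close>

lemma root_inequality:
  fixes a u :: real
  assumes "0 < a" "a < pi / 2" "cos a + sin a / a - 1 = 0" "0 \<le> u" "u \<le> tan a"
  shows "(1 - cos a) * (1 - exp (- (a * u))) \<le> 1 + u * sin a - sqrt (1 + u\<^sup>2)"
proof -
  define b where "b = a\<^sup>2"
  have a13: "13/10 \<le> a" using root_ge_13 assms by blast
  hence b: "169/100 \<le> b" using power_mono[of "13/10" a 2] by (simp add: b_def power2_eq_square)
  note sc = root_sin_cos[OF assms(1-3), folded b_def]
  have al: "1 - cos a = 2 / (b + 1)" unfolding sc(2) using b by (simp add: field_simps)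
  define z where "z = a * u"
  have "tan a = a * (2 / (b + 1)) / ((b - 1) / (b + 1))" unfolding tan_def sc(1) al by (simp only: sc(2))
  also have "\<dots> = a * (2 / (b - 1))" using b by simp
  finally have "tan a = a * (2 / (b - 1))" .
  hence "z \<le> a * (a * (2 / (b - 1)))" unfolding z_def using assms by (intro mult_left_mono) auto
  hence z: "0 \<le> z" "z \<le> 2 * b / (b - 1)" using assms by (auto simp: z_def b_def power2_eq_square mult_ac)
  have "2 * b / (b - 1) \<le> 49 / 10" using b by (simp add: field_simps)
  hence "(b + 1) / 2 * (sqrt (1 + z\<^sup>2 / b) - 1) \<le> exp (- z) - 1 + z"
    using sqrt_term_antimono[of "169/100" b z] exp_ge_sqrt_169[of z] b z by simp
  moreover have "z\<^sup>2 / b = u\<^sup>2" using assms by (simp add: z_def b_def power_mult_distrib)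
  ultimately have "(1 - cos a) * ((b + 1) / 2 * (sqrt (1 + u\<^sup>2) - 1)) \<le> (1 - cos a) * (exp (- z) - 1 + z)"
    using al b by (intro mult_left_mono) auto
  moreover have "(1 - cos a) * ((b + 1) / 2 * (sqrt (1 + u\<^sup>2) - 1)) = sqrt (1 + u\<^sup>2) - 1"
    unfolding al using b by simp
  moreover have "(1 - cos a) * z = u * sin a" unfolding sc(1) z_def by simp
  ultimately show ?thesis unfolding z_def by (simp add: algebra_simps)
qed

section \<open>Sampling without replacement\<close>

lemma card_permutes_cover_insert:
  assumes "finite U" "C \<subseteq> U" "R \<subseteq> U" "i \<in> U - R"
  shows "(card U - card R) * card {\<sigma>. \<sigma> permutes U \<and> insert i R \<subseteq> \<sigma> ` C} =
    (card C - card R) * card {\<sigma>. \<sigma> permutes U \<and> R \<subseteq> \<sigma> ` C}"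
proof -
  define E where "E X = {\<sigma>. \<sigma> permutes U \<and> X \<subseteq> \<sigma> ` C}" for X
  have fin: "finite (E X)" for X
    by (rule finite_subset[OF _ finite_permutations[OF assms(1)]]) (auto simp: E_def)
  have finR: "finite R" using assms finite_subset by blast
  \<comment> \<open>Composition with the transposition of \<open>i\<close> and \<open>j\<close>,
    which fixes \<open>R\<close> pointwise, exchanges the two families of permutations.\<close>
  have sym: "card (E (insert j R)) = card (E (insert i R))" if j: "j \<in> U - R" for j
  proof (rule bij_betw_same_card[of "\<lambda>\<sigma>. Transposition.transpose i j \<circ> \<sigma>"], rule bij_betw_byWitness[where f' = "\<lambda>\<sigma>. Transposition.transpose i j \<circ> \<sigma>"])
    have tr: "Transposition.transpose i j permutes U"
      by (rule permutes_swap_id) (use assms j in simp_all)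
    have "Transposition.transpose i j x = id x" if "x \<in> R" for x
    proof -
      have "x \<noteq> i" "x \<noteq> j" using that assms(4) j by auto
      thus ?thesis by simp
    qed
    hence "Transposition.transpose i j ` R = id ` R" by (rule image_cong[OF refl])
    hence imR: "Transposition.transpose i j ` R = R" by simp
    have *: "Transposition.transpose i j \<circ> \<sigma> \<in> E (insert (Transposition.transpose i j k) R)" if "\<sigma> \<in> E (insert k R)" for \<sigma> k
    proof -
      have "Transposition.transpose i j ` insert k R \<subseteq> Transposition.transpose i j ` \<sigma> ` C" using that by (intro image_mono) (auto simp: E_def)
      thus ?thesis using that permutes_compose[OF _ tr, of \<sigma>] imR by (simp add: E_def image_comp)
    qed
    show "(\<lambda>\<sigma>. Transposition.transpose i j \<circ> \<sigma>) ` E (insert j R) \<subseteq> E (insert i R)"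
      by (rule image_subsetI, drule *) simp
    show "(\<lambda>\<sigma>. Transposition.transpose i j \<circ> \<sigma>) ` E (insert i R) \<subseteq> E (insert j R)"
      by (rule image_subsetI, drule *) simp
    have "Transposition.transpose i j \<circ> (Transposition.transpose i j \<circ> \<sigma>) = \<sigma>" for \<sigma> :: "'a \<Rightarrow> 'a"
      by (rule ext) simp
    thus "\<forall>\<sigma>\<in>E (insert j R). Transposition.transpose i j \<circ> (Transposition.transpose i j \<circ> \<sigma>) = \<sigma>"
      "\<forall>\<sigma>\<in>E (insert i R). Transposition.transpose i j \<circ> (Transposition.transpose i j \<circ> \<sigma>) = \<sigma>"
      by (intro ballI; simp only:)+
  qed
  have "(card U - card R) * card (E (insert i R)) = (\<Sum>j\<in>U - R. card (E (insert i R)))"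
    by (simp add: card_Diff_subset[OF finR assms(3)])
  also have "\<dots> = (\<Sum>j\<in>U - R. card (E (insert j R)))"
    by (rule sum.cong[OF refl]) (rule sym[symmetric])
  also have "\<dots> = (\<Sum>j\<in>U - R. \<Sum>\<sigma>\<in>E R. if j \<in> \<sigma> ` C then 1 else 0)"
  proof (rule sum.cong[OF refl])
    fix j
    have "(\<Sum>\<sigma>\<in>E R. if j \<in> \<sigma> ` C then 1 else 0) = card {\<sigma> \<in> E R. j \<in> \<sigma> ` C}"
      using fin by (simp add: sum.If_cases Int_def)
    also have "{\<sigma> \<in> E R. j \<in> \<sigma> ` C} = E (insert j R)" by (auto simp: E_def)
    finally show "card (E (insert j R)) = (\<Sum>\<sigma>\<in>E R. if j \<in> \<sigma> ` C then 1 else 0)" ..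
  qed
  also have "\<dots> = (\<Sum>\<sigma>\<in>E R. \<Sum>j\<in>U - R. if j \<in> \<sigma> ` C then 1 else 0)" by (rule sum.swap)
  also have "\<dots> = (\<Sum>\<sigma>\<in>E R. card C - card R)"
  proof (rule sum.cong[OF refl])
    fix \<sigma> assume s: "\<sigma> \<in> E R"
    hence p: "\<sigma> permutes U" and sub: "R \<subseteq> \<sigma> ` C" by (auto simp: E_def)
    have "(\<Sum>j\<in>U - R. if j \<in> \<sigma> ` C then 1 else 0) = card ((U - R) \<inter> \<sigma> ` C)"
      using assms(1) by (simp add: sum.If_cases)
    also have "(U - R) \<inter> \<sigma> ` C = \<sigma> ` C - R" using permutes_image[OF p] assms(2) by auto
    also have "card \<dots> = card (\<sigma> ` C) - card R" using sub finR by (simp add: card_Diff_subset)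
    also have "card (\<sigma> ` C) = card C" using permutes_inj_on[OF p] by (simp add: card_image)
    finally show "(\<Sum>j\<in>U - R. if j \<in> \<sigma> ` C then 1 else 0) = card C - card R" .
  qed
  finally show ?thesis by (simp add: E_def mult.commute)
qed

text \<open>Each new element of \<open>R\<close> contributes a factor
  \<open>(card C - card R) / (card U - card R)\<close>, at most \<open>card C / card U\<close>:
  covering is no likelier than for independent draws.\<close>

lemma card_permutes_cover_le:
  assumes "finite U" "C \<subseteq> U" "R \<subseteq> U"
  shows "real (card {\<sigma>. \<sigma> permutes U \<and> R \<subseteq> \<sigma> ` C}) \<le> (card C / card U) ^ card R * fact (card U)"
proof -
  have "finite R" using assms finite_subset by blast
  thus ?thesis using assms(3)
  proof (induction R rule: finite_induct)
    case empty
    thus ?case using assms(1) by (simp add: card_permutations[OF refl])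
  next
    case (insert i R)
    define e where "e X = real (card {\<sigma>. \<sigma> permutes U \<and> X \<subseteq> \<sigma> ` C})" for X
    define p where "p = real (card C) / real (card U)"
    have lt: "card R < card U"
      using insert assms by (intro psubset_card_mono) auto
    have CU: "card C \<le> card U" using assms by (intro card_mono)
    have "(card U - card R) * card {\<sigma>. \<sigma> permutes U \<and> insert i R \<subseteq> \<sigma> ` C} =
        (card C - card R) * card {\<sigma>. \<sigma> permutes U \<and> R \<subseteq> \<sigma> ` C}"
      using insert assms by (intro card_permutes_cover_insert) auto
    hence "real (card U - card R) * e (insert i R) = real (card C - card R) * e R"
      unfolding e_def of_nat_mult[symmetric] by (simp only:)
    also have "real (card C - card R) \<le> p * real (card U - card R)"
    proof (cases "card R \<le> card C")
      case True
      have "real (card C) * real (card R) \<le> real (card U) * real (card R)"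
        using CU by (intro mult_right_mono) auto
      thus ?thesis using True lt by (simp add: p_def field_simps of_nat_diff)
    next
      case False
      thus ?thesis by (simp add: p_def)
    qed
    hence "real (card C - card R) * e R \<le> (p * real (card U - card R)) * e R"
      by (intro mult_right_mono) (auto simp: e_def)
    finally have "e (insert i R) \<le> p * e R" using lt by simp
    also have "\<dots> \<le> p * (p ^ card R * fact (card U))"
      using insert by (intro mult_left_mono) (auto simp: e_def p_def)
    finally show ?case using insert by (simp add: e_def p_def mult_ac)
  qed
qed

text \<open>The moment generating function of a hypergeometric count is at most the binomial one.
  Expanding \<open>z = (z - 1) + 1\<close> over subsets \<open>R\<close> of \<open>S\<close> reduces
  it to covering counts; \<open>1 \<le> z\<close> keeps the coefficients nonnegative.\<close>

lemma sum_permutes_power_le: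
  fixes z :: real
  assumes "finite U" "C \<subseteq> U" "S \<subseteq> U" "1 \<le> z"
  shows "(\<Sum>\<sigma> | \<sigma> permutes U. z ^ card (S \<inter> \<sigma> ` C)) \<le> (1 + (z - 1) * (card C / card U)) ^ card S * fact (card U)"
proof -
  have finS: "finite S" using assms finite_subset by blast
  have expand: "z ^ card (S \<inter> X) = (\<Sum>R\<in>Pow S. (z - 1) ^ card R * (if R \<subseteq> X then 1 else 0))" for X
  proof -
    have "z ^ card (S \<inter> X) = (\<Prod>i\<in>S. if i \<in> X then z else 1)"
      using finS by (simp add: prod.If_cases)
    also have "\<dots> = (\<Prod>i\<in>S. (if i \<in> X then z - 1 else 0) + 1)" by (intro prod.cong) auto
    also have "\<dots> = (\<Sum>R\<in>Pow S. (\<Prod>i\<in>R. if i \<in> X then z - 1 else 0) * (\<Prod>i\<in>S - R. 1))"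
      by (rule prod_add[OF finS])
    also have "\<dots> = (\<Sum>R\<in>Pow S. (z - 1) ^ card R * (if R \<subseteq> X then 1 else 0))"
    proof (intro sum.cong refl)
      fix R assume "R \<in> Pow S"
      hence "finite R" using finS finite_subset by auto
      thus "(\<Prod>i\<in>R. if i \<in> X then z - 1 else 0) * (\<Prod>i\<in>S - R. 1) = (z - 1) ^ card R * (if R \<subseteq> X then 1 else 0)"
        by (auto simp: prod_zero_iff subset_iff intro!: prod.cong[THEN trans, OF refl _ prod_constant])
    qed
    finally show ?thesis .
  qed
  have "(\<Sum>\<sigma> | \<sigma> permutes U. z ^ card (S \<inter> \<sigma> ` C)) =
      (\<Sum>R\<in>Pow S. \<Sum>\<sigma> | \<sigma> permutes U. (z - 1) ^ card R * (if R \<subseteq> \<sigma> ` C then 1 else 0))"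
    unfolding expand by (rule sum.swap)
  also have "\<dots> = (\<Sum>R\<in>Pow S. (z - 1) ^ card R * card {\<sigma>. \<sigma> permutes U \<and> R \<subseteq> \<sigma> ` C})"
    using finite_permutations[OF assms(1)]
    by (intro sum.cong refl) (simp add: sum_distrib_left[symmetric] sum.If_cases Int_def)
  also have "\<dots> \<le> (\<Sum>R\<in>Pow S. (z - 1) ^ card R * ((card C / card U) ^ card R * fact (card U)))"
    using assms by (intro sum_mono mult_left_mono card_permutes_cover_le) auto
  also have "\<dots> = (\<Sum>R\<in>Pow S. (\<Prod>i\<in>R. (z - 1) * (card C / card U)) * (\<Prod>i\<in>S - R. 1)) * fact (card U)"
    unfolding sum_distrib_right prod_constant power_mult_distrib by (intro sum.cong) simp_all
  also have "\<dots> = (\<Prod>i\<in>S. (z - 1) * (card C / card U) + 1) * fact (card U)"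
    by (subst prod_add[OF finS]) simp
  finally show ?thesis by (simp add: add.commute)
qed

text \<open>A Chernoff bound. The moment bound needs \<open>1 \<le> z\<close>, so a deficit in the
  image of \<open>C\<close> is treated as an excess in the image of \<open>U - C\<close>. The set
  \<open>C\<close> may itself fall short of the density \<open>q\<close> by \<open>d / 2\<close>,
  which later absorbs the rounding of phase lengths.\<close>

lemma card_permutes_deficit_le:
  fixes q d :: real
  assumes "finite U" "C \<subseteq> U" "S \<subseteq> U" "0 < d" "d \<le> q" "q \<le> 1" "U \<noteq> {}"
    and C: "(q - d / 2) * card U \<le> card C"
  shows "real (card {\<sigma>. \<sigma> permutes U \<and> card (S \<inter> \<sigma> ` C) < (q - d) * card S}) \<le>
    exp (- (d\<^sup>2 / 16) * card S) * fact (card U)"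
proof -
  define z where "z = 1 + d / 4"
  define \<kappa> where "\<kappa> = (1 - q + d) * real (card S)"
  define N where "N \<sigma> = card (S \<inter> \<sigma> ` (U - C))" for \<sigma>
  define p where "p = real (card (U - C)) / real (card U)"
  let ?P = "{\<sigma>. \<sigma> permutes U}" and ?B = "{\<sigma>. \<sigma> permutes U \<and> card (S \<inter> \<sigma> ` C) < (q - d) * card S}"
  have finP: "finite ?P" by (rule finite_permutations[OF assms(1)])
  have finS: "finite S" using assms finite_subset by blast
  have U0: "card U > 0" using assms by (simp add: card_gt_0_iff)
  have z1: "z \<ge> 1" "z > 0" using assms by (auto simp: z_def)
  have N: "card (S \<inter> \<sigma> ` C) + N \<sigma> = card S" if "\<sigma> permutes U" for \<sigma>
  proof -
    have "S = (S \<inter> \<sigma> ` C) \<union> (S \<inter> \<sigma> ` (U - C))"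
      unfolding Int_Un_distrib[symmetric] image_Un[symmetric]
      using permutes_image[OF that] assms(2,3) by (simp add: Un_absorb1 Int_absorb2)
    moreover have "(S \<inter> \<sigma> ` C) \<inter> (S \<inter> \<sigma> ` (U - C)) = {}"
      using permutes_inj[OF that] by (auto dest: injD)
    ultimately show ?thesis unfolding N_def using finS by (metis card_Un_disjoint finite_Int)
  qed
  have p: "p \<le> 1 - q + d / 2"
  proof -
    have "real (card (U - C)) = real (card U) - real (card C)"
      using assms by (simp add: card_Diff_subset finite_subset card_mono of_nat_diff)
    thus ?thesis using C U0 by (simp add: p_def field_simps)
  qed
  have "real (card ?B) = (\<Sum>\<sigma>\<in>?B. 1)" by simp
  also have "\<dots> \<le> (\<Sum>\<sigma>\<in>?B. z ^ N \<sigma> * exp (- (\<kappa> * ln z)))"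
  proof (rule sum_mono)
    fix \<sigma> assume s: "\<sigma> \<in> ?B"
    hence "real (N \<sigma>) \<ge> \<kappa>" using N[of \<sigma>] unfolding \<kappa>_def by (simp add: algebra_simps) 
    hence "0 \<le> ln z * (N \<sigma> - \<kappa>)" using z1 by simp
    hence "1 \<le> exp (ln z * (N \<sigma> - \<kappa>))" by simp
    also have "\<dots> = exp (real (N \<sigma>) * ln z) * exp (- (\<kappa> * ln z))" by (simp add: algebra_simps flip: exp_add)
    also have "exp (real (N \<sigma>) * ln z) = z ^ N \<sigma>" using z1 by (simp add: exp_of_nat_mult)
    finally show "1 \<le> z ^ N \<sigma> * exp (- (\<kappa> * ln z))" .
  qed
  also have "\<dots> \<le> (\<Sum>\<sigma>\<in>?P. z ^ N \<sigma> * exp (- (\<kappa> * ln z)))"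
    using finP z1 by (intro sum_mono2) auto
  also have "\<dots> = (\<Sum>\<sigma>\<in>?P. z ^ N \<sigma>) * exp (- (\<kappa> * ln z))" by (simp add: sum_distrib_right)
  also have "\<dots> \<le> ((1 + (z - 1) * p) ^ card S * fact (card U)) * exp (- (\<kappa> * ln z))"
    unfolding N_def p_def using assms z1 by (intro mult_right_mono sum_permutes_power_le) auto
  also have "(1 + (z - 1) * p) ^ card S \<le> exp ((z - 1) * p) ^ card S"
    using z1 by (intro power_mono exp_ge_add_one_self) (auto simp: p_def)
  also have "exp ((z - 1) * p) ^ card S = exp (real (card S) * ((z - 1) * p))" by (simp add: exp_of_nat_mult)
  finally have "real (card ?B) \<le> exp (real (card S) * ((z - 1) * p)) * fact (card U) * exp (- (\<kappa> * ln z))"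
    by simp
  also have "\<dots> = exp (real (card S) * ((z - 1) * p - (1 - q + d) * ln z)) * fact (card U)"
    by (simp add: \<kappa>_def algebra_simps flip: exp_add)
  also have "\<dots> \<le> exp (real (card S) * (- (d\<^sup>2 / 16))) * fact (card U)"
  proof (intro mult_right_mono)
    \<comment> \<open>The mean bound for \<open>p\<close> is \<open>d / 2\<close> below
      \<open>w\<close>, which gains \<open>2 * (d^2 / 16)\<close> in the exponent; the quadratic
      error in \<open>ln z\<close> costs at most \<open>d^2 / 16\<close>, because
      \<open>d \<le> q\<close> gives \<open>w \<le> 1\<close>.\<close>
    define w where "w = 1 - q + d"
    have "(z - 1) * p \<le> (d / 4) * (w - d / 2)"
      using p assms unfolding w_def z_def by (intro mult_mono) (auto simp: p_def)
    also have "\<dots> = w * (d / 4) - 2 * (d\<^sup>2 / 16)" by (simp add: right_diff_distrib power2_eq_square)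
    finally have "(z - 1) * p \<le> w * (d / 4) - 2 * (d\<^sup>2 / 16)" .
    moreover have "w * (d / 4 - (d / 4)\<^sup>2) \<le> w * ln z"
      unfolding z_def w_def using assms by (intro mult_left_mono ln_one_plus_pos_lower_bound) auto
    moreover have "w * (d / 4)\<^sup>2 \<le> 1 * (d / 4)\<^sup>2" using assms unfolding w_def by (intro mult_right_mono) auto
    moreover have "(d / 4)\<^sup>2 = d\<^sup>2 / 16" by (simp add: power_divide)
    ultimately have "(z - 1) * p - w * ln z \<le> - (d\<^sup>2 / 16)"
      unfolding right_diff_distrib by linarith
    hence "(z - 1) * p - (1 - q + d) * ln z \<le> - (d\<^sup>2 / 16)" by (simp only: w_def)
    thus "exp (real (card S) * ((z - 1) * p - (1 - q + d) * ln z)) \<le> exp (real (card S) * (- (d\<^sup>2 / 16)))"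
      unfolding exp_le_cancel_iff by (intro mult_left_mono) auto
  qed auto
  finally show ?thesis by (simp add: mult.commute)
qed

section \<open>Sums and survival probabilities over phases\<close>

text \<open>As \<open>f\<close> is constant on the classes of \<open>c\<close>, each
  \<open>f k\<close> with \<open>k\<close> in \<open>T\<close> can be spread evenly over the class
  of \<open>k\<close>; exchanging the sums yields the proportion of each class that lies in
  \<open>T\<close>.\<close>

lemma sum_class_average:
  fixes f :: "'i \<Rightarrow> real" and c :: "'i \<Rightarrow> 'k"
  assumes "finite U" "T \<subseteq> U" and f: "\<And>i j. i \<in> U \<Longrightarrow> j \<in> U \<Longrightarrow> c i = c j \<Longrightarrow> f i = f j"
  shows "(\<Sum>j\<in>T. f j) = (\<Sum>j\<in>U. f j * (card {k \<in> T. c k = c j} / card {k \<in> U. c k = c j}))"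
proof -
  have finT: "finite T" using assms finite_subset by blast
  have "(\<Sum>j\<in>U. f j * (card {k \<in> T. c k = c j} / card {k \<in> U. c k = c j})) =
      (\<Sum>j\<in>U. \<Sum>k\<in>T. if c k = c j then f j / card {k \<in> U. c k = c j} else 0)"
    using finT by (intro sum.cong refl) (simp add: sum.If_cases Int_def)
  also have "\<dots> = (\<Sum>k\<in>T. \<Sum>j\<in>U. if c k = c j then f j / card {k \<in> U. c k = c j} else 0)"
    by (rule sum.swap)
  also have "\<dots> = (\<Sum>k\<in>T. f k)"
  proof (rule sum.cong[OF refl])
    fix k assume k: "k \<in> T"
    define M where "M = card {j \<in> U. c j = c k}"
    have "M > 0" unfolding M_def card_gt_0_iff using k assms by auto
    have "(\<Sum>j\<in>U. if c k = c j then f j / card {k \<in> U. c k = c j} else 0) =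
        (\<Sum>j\<in>U. if c j = c k then f k / M else 0)"
    proof (rule sum.cong[OF refl])
      fix j assume j: "j \<in> U"
      show "(if c k = c j then f j / card {k \<in> U. c k = c j} else 0) = (if c j = c k then f k / M else 0)"
      proof (cases "c j = c k")
        case True
        moreover have "f j = f k" using True j k assms(2) by (intro f) auto
        ultimately show ?thesis by (simp add: M_def)
      qed simp
    qed
    also have "\<dots> = M * (f k / M)"
      using assms(1) by (simp add: sum.If_cases Int_def M_def)
    also have "\<dots> = f k" using \<open>M > 0\<close> by simp
    finally show "(\<Sum>j\<in>U. if c k = c j then f j / card {k \<in> U. c k = c j} else 0) = f k" .
  qed
  finally show ?thesis ..
qed

lemma sum_class_ge:
  fixes \<rho> :: real and f :: "'i \<Rightarrow> real" and c :: "'i \<Rightarrow> 'k"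
  assumes "finite U" "T \<subseteq> U" "\<And>i j. i \<in> U \<Longrightarrow> j \<in> U \<Longrightarrow> c i = c j \<Longrightarrow> f i = f j"
    and "\<And>j. j \<in> U \<Longrightarrow> 0 \<le> f j"
    and \<rho>: "\<And>j. j \<in> U \<Longrightarrow> \<rho> * card {k \<in> U. c k = c j} \<le> card {k \<in> T. c k = c j}"
  shows "\<rho> * (\<Sum>j\<in>U. f j) \<le> (\<Sum>j\<in>T. f j)"
proof -
  have "\<rho> \<le> card {k \<in> T. c k = c j} / card {k \<in> U. c k = c j}" if "j \<in> U" for j
  proof -
    have "0 < card {k \<in> U. c k = c j}" unfolding card_gt_0_iff using that assms(1) by auto
    thus ?thesis using \<rho>[OF that] by (simp add: pos_le_divide_eq)
  qed
  hence "\<rho> * (\<Sum>j\<in>U. f j) \<le> (\<Sum>j\<in>U. f j * (card {k \<in> T. c k = c j} / card {k \<in> U. c k = c j}))"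
    unfolding sum_distrib_left mult.commute[of \<rho>] using assms(4) by (intro sum_mono mult_left_mono) auto
  also have "\<dots> = (\<Sum>j\<in>T. f j)" using assms(1-3) by (intro sum_class_average[symmetric])
  finally show ?thesis .
qed

lemma sum_class_le:
  fixes \<rho> :: real and f :: "'i \<Rightarrow> real" and c :: "'i \<Rightarrow> 'k"
  assumes "finite U" "T \<subseteq> U" "\<And>i j. i \<in> U \<Longrightarrow> j \<in> U \<Longrightarrow> c i = c j \<Longrightarrow> f i = f j"
    and "\<And>j. j \<in> U \<Longrightarrow> 0 \<le> f j"
    and \<rho>: "\<And>j. j \<in> U \<Longrightarrow> card {k \<in> T. c k = c j} \<le> \<rho> * card {k \<in> U. c k = c j}"
  shows "(\<Sum>j\<in>T. f j) \<le> \<rho> * (\<Sum>j\<in>U. f j)"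
proof -
  have "card {k \<in> T. c k = c j} / card {k \<in> U. c k = c j} \<le> \<rho>" if "j \<in> U" for j
  proof -
    have "0 < card {k \<in> U. c k = c j}" unfolding card_gt_0_iff using that assms(1) by auto
    thus ?thesis using \<rho>[OF that] by (simp add: pos_divide_le_eq)
  qed
  hence "(\<Sum>j\<in>U. f j * (card {k \<in> T. c k = c j} / card {k \<in> U. c k = c j})) \<le> \<rho> * (\<Sum>j\<in>U. f j)"
    unfolding sum_distrib_left mult.commute[of \<rho>] using assms(4) by (intro sum_mono mult_left_mono) auto
  moreover have "(\<Sum>j\<in>U. f j * (card {k \<in> T. c k = c j} / card {k \<in> U. c k = c j})) = (\<Sum>j\<in>T. f j)"
    using assms(1-3) by (intro sum_class_average[symmetric])
  ultimately show ?thesis by simp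
qed

section \<open>Sums over the first time of acceptance\<close>

lemma sum_stopping_telescope:
  fixes p :: "nat \<Rightarrow> real"
  shows "(\<Sum>t<N. (\<Prod>u<t. p u) * (1 - p t)) = 1 - (\<Prod>u<N. p u)"
  by (induction N) (simp_all add: algebra_simps)

text \<open>\<open>p t\<close> is the probability of rejecting at time \<open>t\<close> and
  \<open>r t\<close> that of accepting a value that counts. In the first \<open>s\<close> phases
  everything accepted counts, so the sum telescopes; in a later phase the survival up to
  \<open>t\<close> is bounded below by the survival to the end of that phase.\<close>

lemma sum_stopping_chunks_ge:
  fixes p r :: "nat \<Rightarrow> real" and \<omega> :: real
  assumes p: "\<And>t. 0 \<le> p t" "\<And>t. p t \<le> 1" and r: "\<And>t. 0 \<le> r t"
    and early: "\<And>t. t < s * L \<Longrightarrow> r t = 1 - p t"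
    and late: "\<And>i. s \<le> i \<Longrightarrow> i < R \<Longrightarrow> \<omega> \<le> (\<Sum>t\<in>{i * L..<Suc i * L}. r t)"
    and "s \<le> R"
  shows "1 - (\<Prod>t<s * L. p t) + \<omega> * (\<Sum>i\<in>{s..<R}. \<Prod>t<Suc i * L. p t) \<le> (\<Sum>t<R * L. (\<Prod>u<t. p u) * r t)"
  using \<open>s \<le> R\<close> late
proof (induction R rule: dec_induct)
  case base
  have "(\<Sum>t<s * L. (\<Prod>u<t. p u) * r t) = (\<Sum>t<s * L. (\<Prod>u<t. p u) * (1 - p t))"
    by (rule sum.cong) (simp_all add: early)
  thus ?case by (simp add: sum_stopping_telescope)
next
  case (step R)
  define Q where "Q t = (\<Prod>u<t. p u)" for t
  have Qmono: "Q t' \<le> Q t" if "t \<le> t'" for t t'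
    using that
  proof (induction t' rule: dec_induct)
    case (step m)
    have "Q m * p m \<le> Q m * 1" using p by (intro mult_left_mono) (auto simp: Q_def intro: prod_nonneg)
    thus ?case using step by (simp add: Q_def)
  qed simp
  have Q0: "0 \<le> Q t" for t using p by (auto simp: Q_def intro: prod_nonneg)
  have "\<omega> * Q (Suc R * L) \<le> (\<Sum>t\<in>{R * L..<Suc R * L}. r t) * Q (Suc R * L)"
    using step Q0 by (intro mult_right_mono) auto
  also have "\<dots> = (\<Sum>t\<in>{R * L..<Suc R * L}. Q (Suc R * L) * r t)" by (simp add: sum_distrib_left mult.commute)
  also have "\<dots> \<le> (\<Sum>t\<in>{R * L..<Suc R * L}. Q t * r t)"
    using r Qmono by (intro sum_mono mult_right_mono) auto
  finally have "\<omega> * Q (Suc R * L) \<le> (\<Sum>t\<in>{R * L..<Suc R * L}. Q t * r t)" .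
  moreover have "(\<Sum>t<Suc R * L. Q t * r t) = (\<Sum>t<R * L. Q t * r t) + (\<Sum>t\<in>{R * L..<Suc R * L}. Q t * r t)"
    by (subst sum.atLeastLessThan_concat[of 0 "R * L" "Suc R * L", symmetric, unfolded atLeast0LessThan]) auto
  moreover have "1 - Q (s * L) + \<omega> * (\<Sum>i\<in>{s..<R}. Q (Suc i * L)) \<le> (\<Sum>t<R * L. Q t * r t)"
    using step unfolding Q_def by auto
  moreover have "(\<Sum>i\<in>{s..<Suc R}. Q (Suc i * L)) = (\<Sum>i\<in>{s..<R}. Q (Suc i * L)) + Q (Suc R * L)"
    using step by (simp add: sum.atLeastLessThan_Suc)
  ultimately have "1 - Q (s * L) + \<omega> * (\<Sum>i\<in>{s..<Suc R}. Q (Suc i * L)) \<le> (\<Sum>t<Suc R * L. Q t * r t)"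
    by (simp add: distrib_left)
  thus ?case unfolding Q_def .
qed

lemma one_minus_prod_le_sum:
  fixes F :: "'i \<Rightarrow> real"
  assumes "finite A" "\<And>i. i \<in> A \<Longrightarrow> 0 \<le> F i" "\<And>i. i \<in> A \<Longrightarrow> F i \<le> 1"
  shows "1 - (\<Prod>i\<in>A. F i) \<le> (\<Sum>i\<in>A. 1 - F i)"
  using assms
proof (induction A rule: finite_induct)
  case (insert i A)
  have "0 \<le> (1 - F i) * (1 - (\<Prod>i\<in>A. F i))"
    using insert by (intro mult_nonneg_nonneg) (auto intro: prod_le_1)
  thus ?case using insert by (simp add: algebra_simps)
qed simp

lemma one_minus_exp_scale:
  fixes \<theta> v :: real
  assumes "0 \<le> \<theta>" "\<theta> \<le> 1"
  shows "\<theta> * (1 - exp (- v)) \<le> 1 - exp (- (\<theta> * v))"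
  using convex_onD[OF exp_convex, of \<theta> 0 "- v"] assms by (simp add: algebra_simps)

section \<open>Trigonometric estimates and the levels of the phases\<close>

lemma sin_add_le:
  fixes x h :: real
  assumes "0 \<le> x" "0 \<le> h" "x \<le> pi / 2"
  shows "sin (x + h) \<le> sin x + h * cos x"
proof -
  have "sin x * cos h \<le> sin x * 1" using assms by (intro mult_left_mono sin_ge_zero) auto
  moreover have "cos x * sin h \<le> cos x * h" using assms by (intro mult_left_mono cos_ge_zero sin_x_le_x) auto
  ultimately show ?thesis by (simp add: sin_add mult.commute)
qed

text \<open>A Riemann sum of the decreasing function \<open>cos\<close> at left end points, hence
  above its integral. The points start at \<open>Suc s\<close>, so the interval from
  \<open>a * s / K\<close> to \<open>a * Suc s / K\<close> is missing; this accounts for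
  \<open>1 / K\<close>.\<close>

lemma sum_cos_ge:
  fixes a :: real
  assumes "0 < a" "a < pi / 2" "s < K - 1" "2 \<le> K"
  shows "(sin a - sin (a * s / K)) / a - 1 / K \<le> (\<Sum>i\<in>{s..<K - 1}. cos (a * Suc i / K)) / K"
proof -
  have "sin a - sin (a * Suc s / K) = (\<Sum>i\<in>{s..<K - 1}. sin (a * Suc (Suc i) / K) - sin (a * Suc i / K))"
    using sum_Suc_diff'[of s "K - 1" "\<lambda>i. sin (a * Suc i / K)"] assms by simp
  also have "\<dots> \<le> (\<Sum>i\<in>{s..<K - 1}. a / K * cos (a * Suc i / K))"
  proof (rule sum_mono)
    fix i assume i: "i \<in> {s..<K - 1}"
    hence "real (Suc i) \<le> K" by auto
    hence "a * Suc i \<le> a * K" using assms by (intro mult_left_mono) auto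
    hence "a * Suc i / K \<le> a" using assms by (simp add: pos_divide_le_eq)
    hence "a * Suc i / K \<le> pi / 2" using assms by linarith
    hence "sin (a * Suc i / K + a / K) \<le> sin (a * Suc i / K) + a / K * cos (a * Suc i / K)"
      using assms by (intro sin_add_le) auto
    moreover have "a * Suc (Suc i) / K = a * Suc i / K + a / K" by (simp add: algebra_simps add_divide_distrib)
    ultimately show "sin (a * Suc (Suc i) / K) - sin (a * Suc i / K) \<le> a / K * cos (a * Suc i / K)" by simp
  qed
  also have "\<dots> = a * ((\<Sum>i\<in>{s..<K - 1}. cos (a * Suc i / K)) / K)" by (simp add: sum_distrib_left sum_divide_distrib)
  finally have 1: "sin a - sin (a * Suc s / K) \<le> a * ((\<Sum>i\<in>{s..<K - 1}. cos (a * Suc i / K)) / K)" .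
  have "real s \<le> K" using assms by auto
  hence "a * s \<le> a * K" using assms by (intro mult_left_mono) auto
  hence "a * s / K \<le> a" using assms by (simp add: pos_divide_le_eq)
  hence "a * s / K \<le> pi / 2" using assms by linarith
  hence "sin (a * s / K + a / K) \<le> sin (a * s / K) + a / K * cos (a * s / K)"
    using assms by (intro sin_add_le) auto
  also have "a * s / K + a / K = a * Suc s / K" by (simp add: algebra_simps add_divide_distrib)
  also have "a / K * cos (a * s / K) \<le> a / K * 1" using assms by (intro mult_left_mono) auto
  finally have "sin a - sin (a * s / K) - a / K \<le> a * ((\<Sum>i\<in>{s..<K - 1}. cos (a * Suc i / K)) / K)"
    using 1 by simp
  hence "(sin a - sin (a * s / K) - a / K) / a \<le> (\<Sum>i\<in>{s..<K - 1}. cos (a * Suc i / K)) / K"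
    using assms by (simp add: pos_divide_le_eq mult.commute)
  thus ?thesis using assms by (simp add: diff_divide_distrib)
qed

text \<open>The mean value theorem for \<open>- ln (cos t)\<close>, whose derivative
  \<open>tan\<close> is increasing.\<close>

lemma ln_cos_diff_bounds:
  fixes x y :: real
  assumes "0 \<le> x" "x < y" "y < pi / 2"
  shows "(y - x) * tan x \<le> ln (cos x / cos y)" "ln (cos x / cos y) \<le> (y - x) * tan y"
proof -
  have c: "0 < cos t" if "x \<le> t" "t \<le> y" for t using that assms by (intro cos_gt_zero_pi) auto
  have "\<exists>t. x < t \<and> t < y \<and> - ln (cos y) - - ln (cos x) = (y - x) * tan t"
  proof (rule MVT2[OF assms(2)])
    fix t assume t: "x \<le> t" "t \<le> y"
    show "((\<lambda>t. - ln (cos t)) has_real_derivative tan t) (at t)"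
      using c[OF t] by (auto intro!: derivative_eq_intros simp: tan_def)
  qed
  then obtain t where t: "x < t" "t < y" "- ln (cos y) - - ln (cos x) = (y - x) * tan t" by blast
  have "ln (cos x / cos y) = (y - x) * tan t"
    using t(3) c[of x] c[of y] assms by (simp add: ln_div)
  moreover have "tan x \<le> tan t" "tan t \<le> tan y" using t assms by (auto intro!: tan_mono_le)
  ultimately show "(y - x) * tan x \<le> ln (cos x / cos y)" "ln (cos x / cos y) \<le> (y - x) * tan y"
    using assms by (auto intro!: mult_left_mono)
qed

text \<open>The threshold of phase \<open>i\<close> is the quantile of the maximum at \<open>exp (- level a K i)\<close>; the
  levels telescope, which is what makes the survival probabilities cosines.\<close>

definition level :: "real \<Rightarrow> nat \<Rightarrow> nat \<Rightarrow> real" where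
  "level a K i = real K * ln (cos (a * real i / real K) / cos (a * real (Suc i) / real K))"

text \<open>The values of \<open>a * tan\<close> at the phase boundaries separate consecutive
  levels, which yields both their monotonicity and the uniform bound
  \<open>a * tan a\<close>.\<close>

lemma level_bounds:
  fixes a :: real
  assumes "0 < a" "a < pi / 2" "i < K"
  shows "a * tan (a * i / K) \<le> level a K i" "level a K i \<le> a * tan (a * Suc i / K)" "a * Suc i / K \<le> a"
proof -
  have K: "0 < real K" using assms by simp
  have "real (Suc i) \<le> K" using assms by simp
  hence "a * Suc i \<le> a * K" using assms by (intro mult_left_mono) auto
  thus le: "a * Suc i / K \<le> a" using K by (simp add: pos_divide_le_eq)
  have diff: "a * Suc i / K - a * i / K = a / K" by (simp add: algebra_simps add_divide_distrib)
  moreover have "a / K > 0" using assms K by simp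
  ultimately have lt: "a * i / K < a * Suc i / K" by linarith
  have b: "0 \<le> a * i / K" "a * Suc i / K < pi / 2"
    using assms(1) le_less_trans[OF le assms(2)] by auto
  note * = ln_cos_diff_bounds[OF b(1) lt b(2), unfolded diff]
  show "a * tan (a * i / K) \<le> level a K i"
    using mult_left_mono[OF *(1), of "real K"] K by (simp add: level_def)
  show "level a K i \<le> a * tan (a * Suc i / K)"
    using mult_left_mono[OF *(2), of "real K"] K by (simp add: level_def)
qed

lemma level_le:
  fixes a :: real
  assumes "0 < a" "a < pi / 2" "i < K"
  shows "level a K i \<le> a * tan a"
proof -
  have "tan (a * Suc i / K) \<le> tan a"
    using assms level_bounds(3)[OF assms] by (intro tan_mono_le) (auto intro: less_le_trans[of _ 0])
  hence "a * tan (a * Suc i / K) \<le> a * tan a" using assms(1) by (intro mult_left_mono) auto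
  thus ?thesis using level_bounds(2)[OF assms] by linarith
qed

lemma level_mono:
  fixes a :: real
  assumes "0 < a" "a < pi / 2" "i \<le> j" "j < K"
  shows "level a K i \<le> level a K j"
proof (cases "i = j")
  case False
  hence "a * real (Suc i) \<le> a * real j" using assms by (intro mult_left_mono) auto
  hence "a * Suc i / K \<le> a * j / K" by (intro divide_right_mono) auto
  moreover have "a * j / K \<le> a * Suc j / K" using assms by (intro divide_right_mono mult_left_mono) auto
  moreover have "0 \<le> a * Suc i / K" using assms by simp
  moreover have "a * Suc j / K \<le> a" using level_bounds(3)[of a j K] assms by blast
  ultimately have "tan (a * Suc i / K) \<le> tan (a * j / K)"
    using assms by (intro tan_mono_le) linarith+
  hence "a * tan (a * Suc i / K) \<le> a * tan (a * j / K)" using assms by (intro mult_left_mono) auto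
  thus ?thesis using level_bounds(2)[of a i K] level_bounds(1)[of a j K] assms by linarith
qed simp

lemma cos_phase_pos:
  fixes a :: real and s K :: nat
  assumes "0 < a" "a < pi / 2" "s \<le> K"
  shows "0 < cos (a * s / K)"
proof (cases "K = 0")
  case False
  have "a * s \<le> a * K" using assms by (intro mult_left_mono) auto
  hence "a * s / K \<le> a" using False by (simp add: pos_divide_le_eq)
  moreover have "0 \<le> a * s / K" using assms by simp
  ultimately show ?thesis using assms(1,2) by (intro cos_gt_zero_pi) linarith+
qed simp

lemma level_pos:
  fixes a :: real
  assumes "0 < a" "a < pi / 2" "i < K"
  shows "0 < level a K i"
proof -
  have K: "0 < real K" using assms by simp
  have "a * real i < a * real (Suc i)" using assms by (intro mult_strict_left_mono) auto
  hence "a * i / K < a * Suc i / K" using K by (intro divide_strict_right_mono) auto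
  moreover have "0 \<le> a * i / K" using assms by simp
  ultimately have "cos (a * Suc i / K) < cos (a * i / K)"
    using assms level_bounds(3)[OF assms] by (intro cos_monotone_0_pi) auto
  thus ?thesis using K cos_phase_pos[of a "Suc i" K] assms
    by (auto simp: level_def intro!: mult_pos_pos)
qed

lemma sum_level:
  fixes a :: real
  assumes "0 < a" "a < pi / 2" "s \<le> K"
  shows "(\<Sum>i<s. level a K i) = - (K * ln (cos (a * s / K)))"
  using assms(3)
proof (induction s)
  case (Suc s)
  have "0 < cos (a * s / K)" "0 < cos (a * Suc s / K)"
    using Suc assms cos_phase_pos[of a s K] cos_phase_pos[of a "Suc s" K] by auto
  thus ?case using Suc by (simp add: level_def ln_div algebra_simps)
qed simp

text \<open>Cauchy-Schwarz for \<open>(1, u)\<close> and \<open>(cos x, sin x)\<close>; it removes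
  the dependence on the phase in which a given value falls.\<close>

lemma cos_add_sin_le_sqrt: "cos x + u * sin x \<le> sqrt (1 + u\<^sup>2)" for x u :: real
proof (rule real_le_rsqrt)
  have "(cos x + u * sin x)\<^sup>2 = (1 + u\<^sup>2) * ((sin x)\<^sup>2 + (cos x)\<^sup>2) - (u * cos x - sin x)\<^sup>2"
    by algebra
  thus "(cos x + u * sin x)\<^sup>2 \<le> 1 + u\<^sup>2" by (simp only: sin_cos_squared_add) simp
qed

section \<open>Survival probabilities and the gain of the phases\<close>

lemma one_minus_exp_neg_ge: "z * exp (- z) \<le> 1 - exp (- z)" for z :: real
  using mult_right_mono[OF exp_ge_add_one_self[of z], of "exp (- z)"]
  by (simp add: algebra_simps flip: exp_add)

text \<open>In perfect balance the survival of \<open>s\<close> phases is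
  \<open>cos (a * s / K)\<close>; imbalance raises the cosine to the power
  \<open>1 - \<delta>\<close>, and concavity of \<open>1 - exp (- v)\<close> turns this into a
  factor.\<close>

lemma survival_le:
  fixes a S \<delta> :: real and K :: nat
  assumes "0 < a" "a < pi / 2" "s \<le> K" "0 < K" "0 < \<delta>" "\<delta> < 1"
    and "S \<le> exp (- ((1 - \<delta>) / K * (\<Sum>i<s. level a K i)))"
  shows "(1 - \<delta>) * (1 - cos (a * s / K)) \<le> 1 - S"
proof -
  define v where "v = - ln (cos (a * s / K))"
  have "(1 - \<delta>) * (1 - exp (- v)) \<le> 1 - exp (- ((1 - \<delta>) * v))"
    using assms by (intro one_minus_exp_scale) auto
  moreover have "exp (- v) = cos (a * s / K)" using cos_phase_pos[of a s K] assms by (simp add: v_def)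
  moreover have "(1 - \<delta>) / K * (\<Sum>i<s. level a K i) = (1 - \<delta>) * v"
    using assms by (simp add: sum_level v_def)
  ultimately show ?thesis using assms by simp
qed

text \<open>Here the power is \<open>1 + K * \<delta>\<close>. Since every cosine involved is at
  least \<open>cos a\<close>, the surplus power costs at most the fixed factor
  \<open>exp (K * \<delta> * ln (cos a))\<close>.\<close>

lemma survival_ge:
  fixes a S \<delta> :: real and K :: nat
  assumes "0 < a" "a < pi / 2" "s \<le> K" "0 < K" "0 < \<delta>"
    and "exp (- ((1 + K * \<delta>) / K * (\<Sum>i<s. level a K i))) \<le> S"
  shows "exp (K * \<delta> * ln (cos a)) * cos (a * s / K) \<le> S"
proof -
  define v where "v = - ln (cos (a * s / K))"
  have c: "0 < cos (a * s / K)" using cos_phase_pos[of a s K] assms by simp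
  have "a * s \<le> a * K" using assms by (intro mult_left_mono) auto
  hence "a * s / K \<le> a" using assms by (simp add: pos_divide_le_eq)
  hence "cos a \<le> cos (a * s / K)" using assms by (intro cos_monotone_0_pi_le) auto
  hence "ln (cos a) \<le> - v" using assms cos_gt_zero_pi[of a] by (auto simp: v_def)
  hence "K * \<delta> * ln (cos a) \<le> K * \<delta> * - v" using assms by (intro mult_left_mono) auto
  hence "exp (K * \<delta> * ln (cos a)) * exp (- v) \<le> exp (K * \<delta> * - v) * exp (- v)"
    by (intro mult_right_mono) auto
  also have "\<dots> = exp (- ((1 + K * \<delta>) * v))" by (simp add: algebra_simps flip: exp_add)
  also have "(1 + K * \<delta>) * v = (1 + K * \<delta>) / K * (\<Sum>i<s. level a K i)"
    using assms by (simp add: sum_level v_def)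
  finally show ?thesis using assms c by (simp add: v_def)
qed

text \<open>Here \<open>\<Lambda>\<close> stands for \<open>- ln (F x)\<close>. The error factors
  have separate sources: \<open>1 - \<delta>\<close> is imbalance, \<open>1 - a * tan a / K\<close>
  comes from linearising the gain of one phase, the exponential from survival, and
  \<open>exp (a * tan a) / K\<close> from the Riemann sum.\<close>

lemma phase_value_ge:
  fixes a \<Lambda> \<delta> \<omega> :: real and K :: nat and S :: "nat \<Rightarrow> real"
  assumes a: "0 < a" "a < pi / 2" "cos a + sin a / a - 1 = 0"
    and K: "2 \<le> K" "s < K - 1" "a * tan a \<le> K" and \<delta>: "0 < \<delta>" "\<delta> < 1"
    and \<Lambda>: "0 \<le> \<Lambda>" "\<Lambda> \<le> level a K s"
    and \<omega>: "1 - exp (- ((1 - \<delta>) / K * \<Lambda>)) \<le> \<omega>"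
    and Sle: "S s \<le> exp (- ((1 - \<delta>) / K * (\<Sum>i<s. level a K i)))"
    and Sge: "\<And>i. i \<le> K - 1 \<Longrightarrow> exp (- ((1 + K * \<delta>) / K * (\<Sum>j<i. level a K j))) \<le> S i"
  shows "(1 - \<delta>) * (1 - a * tan a / K) * exp (K * \<delta> * ln (cos a)) * (1 - cos a - exp (a * tan a) / K)
      * (1 - exp (- \<Lambda>)) \<le> 1 - S s + \<omega> * (\<Sum>i\<in>{s..<K - 1}. S (Suc i))"
proof -
  define T where "T = a * tan a"
  define \<phi> where "\<phi> = a * s / K"
  define u where "u = \<Lambda> / a"
  define \<nu> where "\<nu> = exp (K * \<delta> * ln (cos a))"
  define C where "C = (\<Sum>i\<in>{s..<K - 1}. cos (a * Suc i / K)) / K"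
  define \<kappa> where "\<kappa> = (1 - T / K) * \<nu>"
  have K0: "0 < real K" using K by simp
  have sK: "s < K" using K by linarith
  have \<Lambda>T: "\<Lambda> \<le> T" using \<Lambda> level_le[OF a(1,2) sK] by (simp add: T_def)
  have TK: "0 \<le> 1 - T / K" "1 - T / K \<le> 1" using K K0 \<Lambda>T \<Lambda>(1) by (auto simp: T_def)
  have \<nu>: "0 \<le> \<nu>" "\<nu> \<le> 1"
    using K0 \<delta> a cos_gt_zero_pi[of a] by (auto simp: \<nu>_def intro!: mult_nonneg_nonpos)
  have \<kappa>: "0 \<le> \<kappa>" "\<kappa> \<le> 1" using TK \<nu> by (auto simp: \<kappa>_def intro!: mult_le_one)
  have C0: "0 \<le> C" unfolding C_def
    using a K0 by (intro divide_nonneg_pos sum_nonneg less_imp_le[OF cos_phase_pos]) auto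
  have \<Lambda>K: "0 \<le> \<Lambda> / K" "\<Lambda> / K \<le> T / K" using \<Lambda> \<Lambda>T K0 by (auto intro: divide_right_mono)
  have "\<Lambda> / K * (1 - T / K) \<le> \<Lambda> / K * exp (- (\<Lambda> / K))"
    using \<Lambda>K exp_ge_add_one_self[of "- (\<Lambda> / K)"] by (intro mult_left_mono) auto
  also have "\<dots> \<le> 1 - exp (- (\<Lambda> / K))" by (rule one_minus_exp_neg_ge)
  finally have "(1 - \<delta>) * (\<Lambda> / K * (1 - T / K)) \<le> (1 - \<delta>) * (1 - exp (- (\<Lambda> / K)))"
    using \<delta> by (intro mult_left_mono) auto
  also have "\<dots> \<le> 1 - exp (- ((1 - \<delta>) * (\<Lambda> / K)))" using \<delta> by (intro one_minus_exp_scale) auto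
  also have "\<dots> \<le> \<omega>" using \<omega> by simp
  finally have \<omega>1: "(1 - \<delta>) * (\<Lambda> / K * (1 - T / K)) \<le> \<omega>" .
  have \<omega>0: "0 \<le> \<omega>" by (rule order_trans[OF _ \<omega>1]) (intro mult_nonneg_nonneg \<Lambda>K TK, use \<delta> in simp)
  have "\<nu> * (K * C) = (\<Sum>i\<in>{s..<K - 1}. \<nu> * cos (a * Suc i / K))"
    using K0 unfolding C_def by (simp add: sum_distrib_left[symmetric])
  also have "\<dots> \<le> (\<Sum>i\<in>{s..<K - 1}. S (Suc i))"
    unfolding \<nu>_def using a K \<delta> by (intro sum_mono survival_ge Sge) auto
  finally have "\<nu> * (K * C) \<le> (\<Sum>i\<in>{s..<K - 1}. S (Suc i))" .
  hence "(1 - \<delta>) * (\<Lambda> / K * (1 - T / K)) * (\<nu> * (K * C)) \<le> \<omega> * (\<Sum>i\<in>{s..<K - 1}. S (Suc i))"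
    using \<omega>1 \<omega>0 \<nu> C0 by (intro mult_mono) auto
  moreover have "(1 - \<delta>) * (\<Lambda> / K * (1 - T / K)) * (\<nu> * (K * C)) = (1 - \<delta>) * (\<kappa> * (\<Lambda> * C))"
    using K0 by (simp add: \<kappa>_def)
  moreover have "(1 - \<delta>) * (1 - cos \<phi>) \<le> 1 - S s"
    unfolding \<phi>_def using a K \<delta> Sle by (intro survival_le) auto
  \<comment> \<open>The early phases do not incur the loss \<open>\<kappa>\<close>; they are
    weakened by it so that one common factor can be taken out.\<close>
  moreover have "(1 - \<delta>) * (\<kappa> * (1 - cos \<phi>)) \<le> (1 - \<delta>) * (1 - cos \<phi>)"
    using \<delta> \<kappa> by (intro mult_left_mono mult_left_le_one_le) auto
  ultimately have "(1 - \<delta>) * (\<kappa> * (1 - cos \<phi>)) + (1 - \<delta>) * (\<kappa> * (\<Lambda> * C)) \<le> 1 - S s + \<omega> * (\<Sum>i\<in>{s..<K - 1}. S (Suc i))"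
    by linarith
  hence main: "(1 - \<delta>) * \<kappa> * (1 - cos \<phi> + \<Lambda> * C) \<le> 1 - S s + \<omega> * (\<Sum>i\<in>{s..<K - 1}. S (Suc i))"
    by (simp add: algebra_simps)
  have "(1 - cos a - exp T / K) * (1 - exp (- \<Lambda>)) \<le> 1 - cos \<phi> + \<Lambda> * C"
  proof -
    have "(sin a - sin \<phi>) / a - 1 / K \<le> C"
      unfolding \<phi>_def C_def using a K by (intro sum_cos_ge) auto
    hence "\<Lambda> * ((sin a - sin \<phi>) / a - 1 / K) \<le> \<Lambda> * C" using \<Lambda> by (intro mult_left_mono) auto
    moreover have "\<Lambda> * ((sin a - sin \<phi>) / a - 1 / K) = u * sin a - u * sin \<phi> - \<Lambda> / K"
      by (simp add: u_def right_diff_distrib diff_divide_distrib)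
    moreover have "cos \<phi> + u * sin \<phi> \<le> sqrt (1 + u\<^sup>2)" by (rule cos_add_sin_le_sqrt)
    moreover have au: "a * u = \<Lambda>" using a by (simp add: u_def)
    have "(1 - cos a) * (1 - exp (- (a * u))) \<le> 1 + u * sin a - sqrt (1 + u\<^sup>2)"
      using a \<Lambda> \<Lambda>T by (intro root_inequality) (auto simp: u_def T_def pos_divide_le_eq mult.commute)
    hence "(1 - cos a) * (1 - exp (- \<Lambda>)) \<le> 1 + u * sin a - sqrt (1 + u\<^sup>2)" unfolding au .
    \<comment> \<open>The additive error of the Riemann sum is made proportional to
      \<open>1 - exp (- \<Lambda>)\<close>, so that it becomes a loss in the ratio even for small
      \<open>\<Lambda>\<close>.\<close>
    moreover have "\<Lambda> / K \<le> exp T / K * (1 - exp (- \<Lambda>))"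
    proof -
      have "\<Lambda> = exp \<Lambda> * (\<Lambda> * exp (- \<Lambda>))" by (simp add: exp_minus)
      also have "\<dots> \<le> exp \<Lambda> * (1 - exp (- \<Lambda>))" by (intro mult_left_mono one_minus_exp_neg_ge) auto
      also have "\<dots> \<le> exp T * (1 - exp (- \<Lambda>))" using \<Lambda> \<Lambda>T by (intro mult_right_mono) auto
      finally have "\<Lambda> / K \<le> exp T * (1 - exp (- \<Lambda>)) / K" using K0 by (intro divide_right_mono) auto
      thus ?thesis by simp
    qed
    ultimately have "(1 - cos a) * (1 - exp (- \<Lambda>)) - exp T / K * (1 - exp (- \<Lambda>)) \<le> 1 - cos \<phi> + \<Lambda> * C"
      by linarith
    thus ?thesis by (simp add: left_diff_distrib)
  qed
  hence "(1 - \<delta>) * \<kappa> * ((1 - cos a - exp T / K) * (1 - exp (- \<Lambda>))) \<le> (1 - \<delta>) * \<kappa> * (1 - cos \<phi> + \<Lambda> * C)"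
    using \<delta> \<kappa> by (intro mult_left_mono) auto
  with main show ?thesis by (simp add: \<kappa>_def \<nu>_def T_def mult.assoc)
qed

text \<open>For a value below the thresholds of all the first \<open>K - 1\<close> phases everything
  accepted there counts. Ignoring the last phase replaces \<open>cos a\<close> by
  \<open>cos (a - a / K)\<close>, a change of at most \<open>a / K\<close>.\<close>

lemma final_phase_value_ge:
  fixes a S \<delta> :: real and K :: nat
  assumes a: "0 < a" "a < pi / 2" and K: "2 \<le> K" and \<delta>: "0 < \<delta>" "\<delta> < 1"
    and "S \<le> exp (- ((1 - \<delta>) / K * (\<Sum>i<K - 1. level a K i)))"
  shows "(1 - \<delta>) * (1 - cos a - a / K) \<le> 1 - S"
proof -
  have "(1 - \<delta>) * (1 - cos (a * (K - 1 :: nat) / K)) \<le> 1 - S"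
    using assms by (intro survival_le) auto
  moreover have "a * (K - 1 :: nat) / K = a - a / K" using K by (simp add: of_nat_diff field_simps)
  moreover have "cos (a - a / K) \<le> cos a + a / K"
  proof -
    have "a * 1 \<le> a * real K" using a K by (intro mult_left_mono) auto
    hence aK: "a / K \<le> a" using K by (simp add: pos_divide_le_eq)
    have "cos a * cos (a / K) \<le> cos a * 1" using a by (intro mult_left_mono cos_ge_zero) auto
    moreover have "sin a * sin (a / K) \<le> 1 * (a / K)"
      using a K by (intro mult_mono sin_x_le_x sin_ge_zero) (use aK in auto)
    ultimately show ?thesis by (simp add: cos_diff)
  qed
  hence "(1 - \<delta>) * (1 - cos a - a / K) \<le> (1 - \<delta>) * (1 - cos (a - a / K))"
    using \<delta> by (intro mult_left_mono) auto
  ultimately show ?thesis by simp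
qed

text \<open>First \<open>K\<close> is chosen large for the limit \<open>\<delta> = 0\<close>, then
  \<open>\<delta>\<close> small depending on \<open>K\<close>; the order matters because the
  survival loss depends on \<open>K * \<delta>\<close>.\<close>

lemma exists_phase_parameters:
  fixes a \<epsilon> :: real
  assumes a: "0 < a" "a < pi / 2" and \<epsilon>: "0 < \<epsilon>"
  shows "\<exists>K::nat. \<exists>\<delta>::real. (2::nat) \<le> K \<and> 0 < \<delta> \<and> \<delta> < 1 \<and> a * tan a \<le> K \<and>
    (1 - \<epsilon>) * (1 - cos a) \<le> (1 - \<delta>) * (1 - a * tan a / K) * exp (K * \<delta> * ln (cos a)) * (1 - cos a - exp (a * tan a) / K) \<and>
    (1 - \<epsilon>) * (1 - cos a) \<le> (1 - \<delta>) * (1 - cos a - a / K)"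
proof -
  have "cos a < cos 0" using a by (intro cos_monotone_0_pi) auto
  hence lt: "(1 - \<epsilon>) * (1 - cos a) < 1 - cos a" using \<epsilon> by (simp add: algebra_simps)
  have lim: "((\<lambda>K::nat. c / real K) \<longlongrightarrow> 0) sequentially" for c :: real by (rule lim_const_over_n)
  have "((\<lambda>K::nat. (1 - a * tan a / K) * (1 - cos a - exp (a * tan a) / K)) \<longlongrightarrow> (1 - 0) * (1 - cos a - 0)) sequentially"
    by (intro tendsto_intros lim)
  hence "eventually (\<lambda>K::nat. (1 - \<epsilon>) * (1 - cos a) < (1 - a * tan a / K) * (1 - cos a - exp (a * tan a) / K)) sequentially"
    using lt by (intro order_tendstoD) auto
  moreover have "((\<lambda>K::nat. 1 - cos a - a / K) \<longlongrightarrow> (1 - cos a - 0)) sequentially"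
    by (intro tendsto_intros lim)
  hence "eventually (\<lambda>K::nat. (1 - \<epsilon>) * (1 - cos a) < 1 - cos a - a / K) sequentially"
    using lt by (intro order_tendstoD) auto
  moreover have "eventually (\<lambda>K::nat. (2::nat) \<le> K) sequentially" by (rule eventually_ge_at_top)
  moreover have "eventually (\<lambda>K::nat. a * tan a \<le> K) sequentially"
    using filterlim_real_sequentially by (auto simp: filterlim_at_top)
  ultimately have "eventually (\<lambda>K::nat. (1 - \<epsilon>) * (1 - cos a) < (1 - a * tan a / K) * (1 - cos a - exp (a * tan a) / K)
    \<and> (1 - \<epsilon>) * (1 - cos a) < 1 - cos a - a / K \<and> (2::nat) \<le> K \<and> a * tan a \<le> K) sequentially"
    by eventually_elim auto
  from eventually_happens'[OF sequentially_bot this] obtain K :: nat where K: "(1 - \<epsilon>) * (1 - cos a) < (1 - a * tan a / K) * (1 - cos a - exp (a * tan a) / K)"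
    "(1 - \<epsilon>) * (1 - cos a) < 1 - cos a - a / K" "(2::nat) \<le> K" "a * tan a \<le> K"
    by (elim exE conjE)
  have lim0: "((\<lambda>\<delta>. (1 - \<delta>) * c * exp (real K * \<delta> * l) * d) \<longlongrightarrow> (1 - 0) * c * exp (real K * 0 * l) * d) (at_right (0::real))"
    for c l d :: real
    by (intro tendsto_intros)
  have "((\<lambda>\<delta>::real. (1 - \<delta>) * (1 - a * tan a / K) * exp (K * \<delta> * ln (cos a)) * (1 - cos a - exp (a * tan a) / K)) \<longlongrightarrow>
      (1 - 0) * (1 - a * tan a / K) * exp (real K * 0 * ln (cos a)) * (1 - cos a - exp (a * tan a) / K)) (at_right 0)"
    by (rule lim0)
  hence "eventually (\<lambda>\<delta>::real. (1 - \<epsilon>) * (1 - cos a) < (1 - \<delta>) * (1 - a * tan a / K) * exp (K * \<delta> * ln (cos a)) * (1 - cos a - exp (a * tan a) / K)) (at_right 0)"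
    using K by (intro order_tendstoD) auto
  moreover have "((\<lambda>\<delta>::real. (1 - \<delta>) * (1 - cos a - a / K)) \<longlongrightarrow> (1 - 0) * (1 - cos a - a / K)) (at_right 0)"
    by (intro tendsto_intros)
  hence "eventually (\<lambda>\<delta>::real. (1 - \<epsilon>) * (1 - cos a) < (1 - \<delta>) * (1 - cos a - a / K)) (at_right 0)"
    using K(2) by (intro order_tendstoD) auto
  moreover have "eventually (\<lambda>\<delta>::real. \<delta> \<in> {0<..<1}) (at_right 0)"
    by (rule eventually_at_right_real) simp
  ultimately have "eventually (\<lambda>\<delta>::real. (1 - \<epsilon>) * (1 - cos a) < (1 - \<delta>) * (1 - a * tan a / K) * exp (K * \<delta> * ln (cos a)) * (1 - cos a - exp (a * tan a) / K)
    \<and> (1 - \<epsilon>) * (1 - cos a) < (1 - \<delta>) * (1 - cos a - a / K) \<and> \<delta> \<in> {0<..<1}) (at_right 0)"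
    by eventually_elim auto
  from eventually_happens'[OF trivial_limit_at_right_real this] obtain \<delta> :: real where "(1 - \<epsilon>) * (1 - cos a) < (1 - \<delta>) * (1 - a * tan a / K) * exp (K * \<delta> * ln (cos a)) * (1 - cos a - exp (a * tan a) / K)
    \<and> (1 - \<epsilon>) * (1 - cos a) < (1 - \<delta>) * (1 - cos a - a / K) \<and> \<delta> \<in> {0<..<1}"
    by (elim exE)
  thus ?thesis using K by (intro exI[of _ K] exI[of _ \<delta>]) auto
qed

section \<open>Distribution of the maximum\<close>

text \<open>Continuity on \<open>J\<close> leaves room for an atom at the left end of \<open>J\<close>, and only there.\<close>

lemma item_dist_left_end:
  assumes "item_dist D"
  obtains l where "0 \<le> l" "measure D {..<l} = 0" "\<And>x. l < x \<Longrightarrow> isCont (cdf D) x"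
proof -
  obtain J where J: "is_interval J" "interior J \<noteq> {}" "J \<subseteq> {0..}" "measure D J = 1" "continuous_on J (cdf D)"
    and "real_distribution D" using assms unfolding item_dist_def by blast
  then interpret real_distribution D by simp
  have Jne: "J \<noteq> {}" using J(2) interior_subset by blast
  have bdd: "bdd_below J" using J(3) by (intro bdd_belowI[of _ 0]) auto
  have JS: "J \<in> sets D" using J(4) measure_notin_sets by fastforce
  have null: "measure D X = 0" if "X \<inter> J = {}" "X \<in> sets borel" for X
  proof -
    have "measure D X \<le> measure D (space D - J)"
      using that JS by (intro finite_measure_mono) auto
    also have "\<dots> = 0" using prob_compl[OF JS] J(4) by simp
    finally show ?thesis using measure_nonneg[of D X] by simp
  qed
  show ?thesis
  proof (rule that[of "Inf J"])
    show "0 \<le> Inf J" using Jne J(3) by (intro cInf_greatest) auto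
    have "\<not> y < Inf J" if "y \<in> J" for y using cInf_lower[OF that bdd] by simp
    thus "measure D {..<Inf J} = 0" by (intro null) auto
    fix x assume x: "Inf J < x"
    show "isCont (cdf D) x" unfolding isCont_cdf
    \<comment> \<open>A point of \<open>J\<close> above \<open>Inf J\<close> has a left
      neighbourhood in \<open>J\<close>, where continuity on \<open>J\<close> excludes a jump; a
      point outside \<open>J\<close> carries no mass.\<close>
    proof (cases "x \<in> J")
      case True
      obtain y where y: "y \<in> J" "y < x" using x Jne bdd by (meson cInf_lessD)
      have sub: "{y..x} \<subseteq> J" using J(1) y True unfolding is_interval_1 by (meson atLeastAtMost_iff subsetI)
      have "(cdf D \<longlongrightarrow> cdf D x) (at x within {y..x})"
        using continuous_on_subset[OF J(5) sub] y(2) by (auto simp: continuous_on_def)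
      hence "(cdf D \<longlongrightarrow> cdf D x) (at_left x)"
        using at_within_Icc_at_left[OF y(2)] by simp
      hence "measure D {..<x} = cdf D x"
        using tendsto_unique[OF trivial_limit_at_left_real cdf_at_left[of x]] by blast
      moreover have "measure D {..x} = measure D {..<x} + measure D {x}"
        by (subst finite_measure_Union[symmetric]) (auto simp: ivl_disj_un_singleton(2)[symmetric])
      ultimately show "measure D {x} = 0" by (simp add: cdf_def)
    next
      case False
      thus "measure D {x} = 0" by (intro null) auto
    qed
  qed
qed

text \<open>The infimum of the points where \<open>F\<close> reaches \<open>q\<close>. Right
  continuity gives \<open>q \<le> F \<theta>\<close>; at an atom \<open>F\<close> may jump over
  \<open>q\<close>, so equality is only claimed at continuity points.\<close>

lemma exists_quantile:
  fixes F :: "real \<Rightarrow> real"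
  assumes "mono F" "\<And>x. continuous (at_right x) F" "\<And>x. x < 0 \<Longrightarrow> F x = 0" "(F \<longlongrightarrow> 1) at_top"
    and q: "0 < q" "q < 1"
  obtains \<theta> where "0 \<le> \<theta>" "q \<le> F \<theta>" "\<And>y. y < \<theta> \<Longrightarrow> F y < q" "isCont F \<theta> \<Longrightarrow> F \<theta> = q"
proof -
  define Q where "Q = {y. q \<le> F y}"
  define \<theta> where "\<theta> = Inf Q"
  have "eventually (\<lambda>y. q < F y) at_top" using assms by (intro order_tendstoD) auto
  then obtain y0 where "q < F y0" using eventually_happens'[OF trivial_limit_at_top_linorder] by blast
  hence ne: "Q \<noteq> {}" by (auto simp: Q_def intro: less_imp_le)
  have Q0: "0 \<le> y" if "y \<in> Q" for y using that assms(3)[of y] q by (force simp: Q_def not_less)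
  hence bdd: "bdd_below Q" by (intro bdd_belowI[of _ 0])
  have below: "F y < q" if "y < \<theta>" for y
    using that cInf_lower[OF _ bdd, of y] by (force simp: \<theta>_def Q_def not_le)
  have above: "q \<le> F y" if y: "\<theta> < y" for y
  proof -
    obtain z where "z \<in> Q" "z < y" using y ne bdd unfolding \<theta>_def by (meson cInf_lessD)
    thus ?thesis using monoD[OF assms(1), of z y] by (auto simp: Q_def)
  qed
  have "(F \<longlongrightarrow> F \<theta>) (at_right \<theta>)" using assms(2) by (simp add: continuous_within)
  moreover have "eventually (\<lambda>y. q \<le> F y) (at_right \<theta>)"
    using above by (auto simp: eventually_at_filter)
  ultimately have ge: "q \<le> F \<theta>" by (intro tendsto_lowerbound[of F _ "at_right \<theta>"]) auto
  show ?thesis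
  proof (rule that[of \<theta>])
    show "0 \<le> \<theta>" unfolding \<theta>_def using ne Q0 by (intro cInf_greatest)
    show "q \<le> F \<theta>" by (rule ge)
    show "F y < q" if "y < \<theta>" for y by (rule below[OF that])
    assume "isCont F \<theta>"
    hence "(F \<longlongrightarrow> F \<theta>) (at_left \<theta>)" by (simp add: isCont_def filterlim_at_split)
    moreover have "eventually (\<lambda>y. F y \<le> q) (at_left \<theta>)"
      using below by (auto simp: eventually_at_filter intro!: always_eventually less_imp_le)
    ultimately have "F \<theta> \<le> q" by (intro tendsto_upperbound[of F _ "at_left \<theta>"]) auto
    thus "F \<theta> = q" using ge by simp
  qed
qed

text \<open>Every index carries an item law, not only those below \<open>n\<close>, because
  \<open>product_prob_space\<close> asks for a probability measure at each index.\<close>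

locale items =
  fixes n :: nat and D :: "nat \<Rightarrow> real measure"
  assumes n_pos: "0 < n" and item: "\<And>i. item_dist (D i)"
begin

lemma real_dist: "real_distribution (D i)" using item unfolding item_dist_def by blast

sublocale dist: real_distribution "D i" for i by (rule real_dist)

sublocale product_prob_space D "{..<n}" by unfold_locales

definition max_cdf :: "real \<Rightarrow> real" where
  "max_cdf x = (\<Prod>j<n. cdf (D j) x)"

lemma cdf_neg: "cdf (D i) x = 0" if "x < 0"
proof -
  obtain l where l: "0 \<le> l" "measure (D i) {..<l} = 0" by (rule item_dist_left_end[OF item])
  have "measure (D i) {..x} \<le> measure (D i) {..<l}" using that l by (intro dist.finite_measure_mono) auto
  thus ?thesis using l measure_nonneg[of "D i" "{..x}"] by (simp add: cdf_def)
qed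

lemma max_cdf_nonneg: "0 \<le> max_cdf x" and max_cdf_le_1: "max_cdf x \<le> 1"
  unfolding max_cdf_def by (auto intro!: prod_nonneg prod_le_1 dist.cdf_nonneg dist.cdf_bounded_prob)

lemma max_cdf_mono: "mono max_cdf"
  unfolding max_cdf_def by (intro monoI prod_mono) (auto intro: dist.cdf_nonneg dist.cdf_nondecreasing)

lemma max_cdf_quantile:
  assumes "0 < q" "q < 1"
  obtains \<theta> where "0 \<le> \<theta>" "q \<le> max_cdf \<theta>" "\<And>y. y < \<theta> \<Longrightarrow> max_cdf y < q" "isCont max_cdf \<theta> \<Longrightarrow> max_cdf \<theta> = q"
proof -
  have 1:  "continuous (at_right x) max_cdf" for x
    unfolding max_cdf_def[abs_def] by (intro continuous_prod dist.cdf_is_right_cont)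
  have 2: "max_cdf x = 0" if "x < 0" for x
    unfolding max_cdf_def using n_pos cdf_neg[OF that] by (intro prod_zero) auto
  have "((\<lambda>x. \<Prod>j<n. cdf (D j) x) \<longlongrightarrow> (\<Prod>j<n. 1)) at_top"
    by (intro tendsto_prod dist.cdf_lim_at_top_prob)
  hence 3: "(max_cdf \<longlongrightarrow> 1) at_top" by (simp add: max_cdf_def[abs_def])
  show ?thesis by (rule exists_quantile[OF max_cdf_mono 1 2 3 assms]) (assumption | rule that)+
qed

text \<open>\<open>l\<close> is the largest of the left ends. The item \<open>j\<close> attaining it
  keeps the maximum above \<open>l\<close> almost surely, while beyond \<open>l\<close> every factor
  of \<open>max_cdf\<close> is continuous.\<close>

lemma max_left_end:
  obtains l j where "0 \<le> l" "j < n" "measure (D j) {..<l} = 0" "\<And>x. l < x \<Longrightarrow> isCont max_cdf x"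
proof -
  have "\<exists>l\<ge>0. measure (D i) {..<l} = 0 \<and> (\<forall>x>l. isCont (cdf (D i)) x)" for i
    by (rule item_dist_left_end[OF item[of i]]) blast
  then obtain f where f: "\<And>i. 0 \<le> f i" "\<And>i. measure (D i) {..<f i} = 0" "\<And>i x. f i < x \<Longrightarrow> isCont (cdf (D i)) x"
    by metis
  have fin: "finite (f ` {..<n})" "f ` {..<n} \<noteq> {}" using n_pos by auto
  obtain j where j: "j < n" "f j = Max (f ` {..<n})" using Max_in[OF fin] by auto
  show ?thesis
  proof (rule that[of "f j" j])
    show "isCont max_cdf x" if "f j < x" for x unfolding max_cdf_def[abs_def]
    proof (intro continuous_prod f(3))
      fix i assume "i \<in> {..<n}"
      hence "f i \<le> f j" unfolding j(2) using fin by (intro Max_ge) auto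
      thus "f i < x" using that by simp
    qed
  qed (rule f j(1))+
qed

end

section \<open>The threshold algorithm on a balanced order\<close>

context items
begin

definition same_law :: "nat \<Rightarrow> nat set" where
  "same_law j = {k \<in> {..<n}. cdf (D k) = cdf (D j)}"

text \<open>The length is rounded down: for positive \<open>K\<close>, the fewer than
  \<open>K\<close> times left over at the end belong to none of the first \<open>K\<close>
  phases.\<close>

definition phase :: "nat \<Rightarrow> nat \<Rightarrow> nat set" where
  "phase K i = {i * (n div K)..<Suc i * (n div K)}"

text \<open>Only lower bounds are required. Upper bounds follow from them, since the phases are
  disjoint.\<close>

definition balanced :: "nat \<Rightarrow> real \<Rightarrow> (nat \<Rightarrow> nat) \<Rightarrow> bool" where
  "balanced K \<delta> \<sigma> \<longleftrightarrow> (\<forall>i<K. \<forall>j<n. (1 - \<delta>) / K * card (same_law j) \<le> card (same_law j \<inter> \<sigma> ` phase K i))"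

lemma phase_subset: "i < K \<Longrightarrow> phase K i \<subseteq> {..<n}"
proof -
  assume "i < K"
  hence "Suc i * (n div K) \<le> K * (n div K)" by (intro mult_le_mono1) simp
  also have "\<dots> \<le> n" by simp
  finally show ?thesis unfolding phase_def by auto
qed

lemma phase_disjoint: "i \<noteq> i' \<Longrightarrow> phase K i \<inter> phase K i' = {}"
proof (induction i i' rule: linorder_wlog)
  case (le i i')
  hence "Suc i * (n div K) \<le> i' * (n div K)" by (intro mult_le_mono1) simp
  thus ?case unfolding phase_def by auto
qed (simp add: Int_commute)

lemma finite_phase: "finite (phase K i)" by (simp add: phase_def)

text \<open>The other \<open>K - 1\<close> phases already contain a share
  \<open>(1 - \<delta>) / K\<close> of the class each, which leaves at most
  \<open>(1 + (K - 1) * \<delta>) / K\<close>.\<close>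

lemma card_phase_le:
  assumes \<sigma>: "\<sigma> permutes {..<n}" and bal: "balanced K \<delta> \<sigma>" and "i < K" "j < n" "0 < \<delta>"
  shows "card (same_law j \<inter> \<sigma> ` phase K i) \<le> (1 + K * \<delta>) / K * card (same_law j)"
proof -
  define M where "M = real (card (same_law j))"
  define N where "N i = card (same_law j \<inter> \<sigma> ` phase K i)" for i
  have K: "0 < real K" using assms by simp
  have fin: "finite (same_law j)" by (simp add: same_law_def)
  have "(\<Sum>i<K. N i) = card (\<Union>i\<in>{..<K}. same_law j \<inter> \<sigma> ` phase K i)"
    unfolding N_def
  proof (rule card_UN_disjoint[symmetric])
    show "\<forall>i\<in>{..<K}. \<forall>i'\<in>{..<K}. i \<noteq> i' \<longrightarrow> (same_law j \<inter> \<sigma> ` phase K i) \<inter> (same_law j \<inter> \<sigma> ` phase K i') = {}"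
    proof (intro ballI impI)
      fix i i' :: nat assume "i \<noteq> i'"
      hence "\<sigma> ` phase K i \<inter> \<sigma> ` phase K i' = {}"
        unfolding image_Int[OF permutes_inj[OF \<sigma>], symmetric] by (simp add: phase_disjoint)
      thus "(same_law j \<inter> \<sigma> ` phase K i) \<inter> (same_law j \<inter> \<sigma> ` phase K i') = {}" by blast
    qed
  qed (use fin in auto)
  also have "\<dots> \<le> card (same_law j)" using fin by (intro card_mono) auto
  finally have "(\<Sum>i<K. real (N i)) \<le> M" 
    unfolding M_def by (simp only: of_nat_sum[symmetric] of_nat_le_iff)
  moreover have "(\<Sum>i<K. real (N i)) = real (N i) + (\<Sum>i'\<in>{..<K} - {i}. real (N i'))"
    using assms by (intro sum.remove) auto
  moreover have "(\<Sum>i'\<in>{..<K} - {i}. (1 - \<delta>) / K * M) \<le> (\<Sum>i'\<in>{..<K} - {i}. real (N i'))"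
    using bal assms unfolding balanced_def M_def N_def by (intro sum_mono) auto
  moreover have "(\<Sum>i'\<in>{..<K} - {i}. (1 - \<delta>) / K * M) = (real K - 1) * ((1 - \<delta>) / K * M)"
    using assms by (simp add: of_nat_diff)
  ultimately have "real (N i) \<le> M - (real K - 1) * ((1 - \<delta>) / K * M)" by linarith
  also have "\<dots> = (1 + K * \<delta>) / K * M - \<delta> / K * M"
    using K by (simp add: field_simps)
  also have "\<dots> \<le> (1 + K * \<delta>) / K * M" using assms K by (simp add: M_def)
  finally show ?thesis by (simp add: N_def M_def)
qed

text \<open>After taking logarithms the product becomes a sum of nonnegative terms that are constant
  on each class and total \<open>- ln (max_cdf y)\<close>, so balance determines the share of a
  phase.\<close>

lemma phase_prod_bounds:
  assumes \<sigma>: "\<sigma> permutes {..<n}" and bal: "balanced K \<delta> \<sigma>" and "i < K" "0 < \<delta>" and pos: "0 < max_cdf y"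
  shows "(\<Prod>t\<in>phase K i. cdf (D (\<sigma> t)) y) \<le> exp (- ((1 - \<delta>) / K * - ln (max_cdf y)))" (is ?A)
    and "exp (- ((1 + K * \<delta>) / K * - ln (max_cdf y))) \<le> (\<Prod>t\<in>phase K i. cdf (D (\<sigma> t)) y)" (is ?B)
proof -
  define f where "f j = - ln (cdf (D j) y)" for j
  let ?T = "\<sigma> ` phase K i"
  have cpos: "0 < cdf (D j) y" if "j < n" for j
  proof -
    have "max_cdf y = 0" if "cdf (D j) y = 0"
      unfolding max_cdf_def using that \<open>j < n\<close> by (intro prod_zero) auto
    thus ?thesis using dist.cdf_nonneg[of j y] pos by force
  qed
  have f0: "0 \<le> f j" if "j < n" for j
    using cpos[OF that] dist.cdf_bounded_prob[of j y] by (simp add: f_def ln_le_zero_iff)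
  have sub: "?T \<subseteq> {..<n}" using phase_subset[OF \<open>i < K\<close>] permutes_image[OF \<sigma>] by blast
  have total: "(\<Sum>j<n. f j) = - ln (max_cdf y)"
    unfolding max_cdf_def f_def by (subst ln_prod) (auto simp: sum_negf dest: cpos)
  have "(\<Prod>t\<in>phase K i. cdf (D (\<sigma> t)) y) = (\<Prod>j\<in>?T. cdf (D j) y)"
    using permutes_inj_on[OF \<sigma>] by (simp add: prod.reindex)
  also have "\<dots> = (\<Prod>j\<in>?T. exp (- f j))"
    using sub cpos by (intro prod.cong) (auto simp: f_def subset_iff)
  also have "\<dots> = exp (- (\<Sum>j\<in>?T. f j))" by (simp add: exp_sum finite_phase sum_negf flip: sum_negf)
  finally have prod: "(\<Prod>t\<in>phase K i. cdf (D (\<sigma> t)) y) = exp (- (\<Sum>j\<in>?T. f j))" .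
  have cls: "{k \<in> {..<n}. cdf (D k) = cdf (D j)} = same_law j"
    "{k \<in> ?T. cdf (D k) = cdf (D j)} = same_law j \<inter> ?T" for j
    using sub by (auto simp: same_law_def)
  have "(1 - \<delta>) / K * (\<Sum>j<n. f j) \<le> (\<Sum>j\<in>?T. f j)"
  proof (rule sum_class_ge[where c = "\<lambda>j. cdf (D j)"])
    show "(1 - \<delta>) / K * card {k \<in> {..<n}. cdf (D k) = cdf (D j)} \<le> card {k \<in> ?T. cdf (D k) = cdf (D j)}"
      if "j \<in> {..<n}" for j using bal that \<open>i < K\<close> unfolding cls balanced_def by blast
  qed (use sub f0 in \<open>auto simp: f_def\<close>)
  thus ?A unfolding prod total by simp
  have "(\<Sum>j\<in>?T. f j) \<le> (1 + K * \<delta>) / K * (\<Sum>j<n. f j)"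
  proof (rule sum_class_le[where c = "\<lambda>j. cdf (D j)"])
    show "card {k \<in> ?T. cdf (D k) = cdf (D j)} \<le> (1 + K * \<delta>) / K * card {k \<in> {..<n}. cdf (D k) = cdf (D j)}"
      if "j \<in> {..<n}" for j using card_phase_le[OF \<sigma> bal \<open>i < K\<close>] that \<open>0 < \<delta>\<close> unfolding cls by blast
  qed (use sub f0 in \<open>auto simp: f_def\<close>)
  thus ?B unfolding prod total by simp
qed

text \<open>The strict inequality makes the rejection probability equal to the distribution function
  at the threshold. In the last phase \<open>{l..}\<close> is closed so that an atom at
  \<open>l\<close> is accepted; leftover times accept nothing.\<close>

definition accept_set :: "nat \<Rightarrow> (nat \<Rightarrow> real) \<Rightarrow> real \<Rightarrow> nat \<Rightarrow> real set" where
  "accept_set K \<theta> l t =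
     (if t < (K - 1) * (n div K) then {\<theta> (t div (n div K))<..}
      else if t < K * (n div K) then {l..} else {})"

lemma accept_set_borel [measurable]: "accept_set K \<theta> l t \<in> sets borel"
  by (simp add: accept_set_def)

lemma accept_set_phase:
  assumes "i < K - 1" "t \<in> phase K i"
  shows "accept_set K \<theta> l t = {\<theta> i<..}"
proof -
  have t: "i * (n div K) \<le> t" "t < Suc i * (n div K)" using assms by (auto simp: phase_def)
  have "Suc i * (n div K) \<le> (K - 1) * (n div K)" using assms by (intro mult_le_mono1) simp
  hence "t < (K - 1) * (n div K)" using t by linarith
  moreover have "t div (n div K) = i" using t by (intro div_nat_eqI) (simp_all add: mult.commute)
  ultimately show ?thesis by (simp add: accept_set_def)
qed

lemma prod_phases:
  fixes p :: "nat \<Rightarrow> real"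
  shows "(\<Prod>t<Suc i * (n div K). p t) = (\<Prod>t<i * (n div K). p t) * (\<Prod>t\<in>phase K i. p t)"
  unfolding phase_def
  by (subst prod.atLeastLessThan_concat[of 0 "i * (n div K)" "Suc i * (n div K)", symmetric, unfolded atLeast0LessThan]) auto

text \<open>The right side is the probability of accepting a value above \<open>x\<close>, split by
  the time of acceptance. For \<open>x < l\<close> every accepted value counts and acceptance is
  certain; for \<open>x \<ge> l\<close> the first phase with threshold at most \<open>x\<close>
  separates the phases where everything counts from the later ones.\<close>

lemma order_value_ge:
  fixes a \<delta> \<beta> l x :: real and K :: nat and \<theta> :: "nat \<Rightarrow> real"
  assumes a: "0 < a" "a < pi / 2" "cos a + sin a / a - 1 = 0"
    and K: "2 \<le> K" "a * tan a \<le> K" and \<delta>: "0 < \<delta>" "\<delta> < 1"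
    and \<beta>: "0 \<le> \<beta>" "\<beta> \<le> 1"
      "\<beta> \<le> (1 - \<delta>) * (1 - a * tan a / K) * exp (K * \<delta> * ln (cos a)) * (1 - cos a - exp (a * tan a) / K)"
      "\<beta> \<le> (1 - \<delta>) * (1 - cos a - a / K)"
    and \<sigma>: "\<sigma> permutes {..<n}" and bal: "balanced K \<delta> \<sigma>"
    and l: "j0 < n" "measure (D j0) {..<l} = 0" "\<And>y. l < y \<Longrightarrow> isCont max_cdf y"
    and \<theta>: "\<And>i. i < K - 1 \<Longrightarrow> exp (- level a K i) \<le> max_cdf (\<theta> i)"
      "\<And>i y. i < K - 1 \<Longrightarrow> y < \<theta> i \<Longrightarrow> max_cdf y < exp (- level a K i)"
      "\<And>i. i < K - 1 \<Longrightarrow> isCont max_cdf (\<theta> i) \<Longrightarrow> max_cdf (\<theta> i) = exp (- level a K i)"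
  shows "\<beta> * (1 - max_cdf x) \<le>
    (\<Sum>t<n. (\<Prod>u<t. measure (D (\<sigma> u)) (- accept_set K \<theta> l u)) * measure (D (\<sigma> t)) (accept_set K \<theta> l t \<inter> {x<..}))"
proof -
  define L where "L = n div K"
  define R where "R = K - 1"
  define p where "p t = measure (D (\<sigma> t)) (- accept_set K \<theta> l t)" for t
  define r where "r t = measure (D (\<sigma> t)) (accept_set K \<theta> l t \<inter> {x<..})" for t
  define S where "S i = (\<Prod>t<i * L. p t)" for i
  have p01: "0 \<le> p t" "p t \<le> 1" and r0: "0 \<le> r t" for t
    by (simp_all add: p_def r_def dist.prob_le_1)
  have compl: "measure (D i) (- X) = 1 - measure (D i) X" if "X \<in> sets borel" for i X
    using dist.prob_compl[of X i] that by (simp add: Compl_eq_Diff_UNIV)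
  have KL: "K * L \<le> n" unfolding L_def by simp
  have "R * L \<le> K * L" unfolding R_def by (intro mult_le_mono1) simp
  hence RL: "R * L \<le> n" using KL by linarith
  have p_phase: "p t = cdf (D (\<sigma> t)) (\<theta> i)" if "i < R" "t \<in> phase K i" for i t
  proof -
    have "- {\<theta> i<..} = {..\<theta> i}" by auto
    thus ?thesis using accept_set_phase[of i K t] that by (simp add: p_def R_def cdf_def)
  qed
  have pos: "0 < max_cdf (\<theta> i)" if "i < R" for i
    using \<theta>(1)[of i] that by (intro less_le_trans[OF exp_gt_zero]) (auto simp: R_def)
  have lev: "- ln (max_cdf (\<theta> i)) \<le> level a K i" if "i < R" for i
  proof -
    have "ln (exp (- level a K i)) \<le> ln (max_cdf (\<theta> i))"
      using \<theta>(1)[of i] pos[OF that] that by (subst ln_le_cancel_iff) (auto simp: R_def)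
    thus ?thesis by simp
  qed
  have S_Suc: "S (Suc i) = S i * (\<Prod>t\<in>phase K i. cdf (D (\<sigma> t)) (\<theta> i))" if "i < R" for i
    unfolding S_def L_def prod_phases using p_phase[OF that] by simp
  have S0: "0 \<le> S i" for i unfolding S_def using p01 by (intro prod_nonneg) auto
  have Sge: "exp (- ((1 + K * \<delta>) / K * (\<Sum>j<i. level a K j))) \<le> S i" if "i \<le> R" for i
    using that
  proof (induction i)
    case (Suc i)
    have iK: "i < K" "i < R" using Suc by (auto simp: R_def)
    have "exp (- ((1 + K * \<delta>) / K * (\<Sum>j<Suc i. level a K j))) =
        exp (- ((1 + K * \<delta>) / K * (\<Sum>j<i. level a K j))) * exp (- ((1 + K * \<delta>) / K * level a K i))"
      by (simp add: distrib_left flip: exp_add)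
    also have "exp (- ((1 + K * \<delta>) / K * level a K i)) \<le> exp (- ((1 + K * \<delta>) / K * - ln (max_cdf (\<theta> i))))"
      unfolding exp_le_cancel_iff neg_le_iff_le using lev[OF iK(2)] \<delta> by (intro mult_left_mono) auto
    also have "\<dots> \<le> (\<Prod>t\<in>phase K i. cdf (D (\<sigma> t)) (\<theta> i))"
      by (rule phase_prod_bounds(2)[OF \<sigma> bal iK(1) \<delta>(1) pos[OF iK(2)]])
    also have "exp (- ((1 + K * \<delta>) / K * (\<Sum>j<i. level a K j))) * (\<Prod>t\<in>phase K i. cdf (D (\<sigma> t)) (\<theta> i)) \<le> S (Suc i)"
      unfolding S_Suc[OF iK(2)] using Suc
      by (intro mult_right_mono prod_nonneg) (auto intro: dist.cdf_nonneg)
    finally show ?case by (simp add: mult_left_mono)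
  qed (simp add: S_def)
  \<comment> \<open>Unlike the lower bound, this needs the thresholds to attain their levels
    exactly, hence the requirement that they lie beyond the possible atom at
    \<open>l\<close>.\<close>
  have Sle: "S i \<le> exp (- ((1 - \<delta>) / K * (\<Sum>j<i. level a K j)))" if "i \<le> R" "\<And>j. j < i \<Longrightarrow> l < \<theta> j" for i
    using that
  proof (induction i)
    case (Suc i)
    have iK: "i < K" "i < R" using Suc by (auto simp: R_def)
    have "max_cdf (\<theta> i) = exp (- level a K i)" using iK Suc l(3) by (intro \<theta>(3)) (auto simp: R_def)
    hence lev': "- ln (max_cdf (\<theta> i)) = level a K i" by simp
    have "S (Suc i) \<le> exp (- ((1 - \<delta>) / K * (\<Sum>j<i. level a K j))) * exp (- ((1 - \<delta>) / K * level a K i))"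
      unfolding S_Suc[OF iK(2)] lev'[symmetric] using Suc
      by (intro mult_mono phase_prod_bounds(1)[OF \<sigma> bal iK(1) \<delta>(1) pos[OF iK(2)]] prod_nonneg)
        (auto intro: dist.cdf_nonneg)
    also have "\<dots> = exp (- ((1 - \<delta>) / K * (\<Sum>j<Suc i. level a K j)))"
      by (simp add: distrib_left flip: exp_add)
    finally show ?case .
  qed (simp add: S_def)
  have F0: "max_cdf y = 0" if "y < l" for y
  proof -
    have "measure (D j0) {..y} \<le> measure (D j0) {..<l}" using that by (intro dist.finite_measure_mono) auto
    hence "cdf (D j0) y = 0" using l(2) measure_nonneg[of "D j0" "{..y}"] by (simp add: cdf_def)
    thus ?thesis unfolding max_cdf_def using l(1) by (intro prod_zero) auto
  qed
  have "\<beta> * (1 - max_cdf x) \<le> (\<Sum>t<n. (\<Prod>u<t. p u) * r t)"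
  proof (cases "x < l")
    case True
    have l\<theta>: "l \<le> \<theta> i" if "i < R" for i using F0[of "\<theta> i"] pos[OF that] by force
    have sub: "accept_set K \<theta> l t \<subseteq> {x<..}" for t
    proof (cases "t < R * L")
      case T: True
      hence "t div L < R" by (simp add: less_mult_imp_div_less)
      hence "l \<le> \<theta> (t div L)" by (rule l\<theta>)
      thus ?thesis using True T unfolding accept_set_def R_def L_def by auto
    qed (use True in \<open>auto simp: accept_set_def R_def L_def\<close>)
    have "r t = 1 - p t" for t
      using sub[of t] compl[of "accept_set K \<theta> l t"] by (simp add: r_def p_def Int_absorb2)
    hence "(\<Sum>t<n. (\<Prod>u<t. p u) * r t) = 1 - (\<Prod>u<n. p u)" by (simp add: sum_stopping_telescope)
    \<comment> \<open>By balance the last phase contains an item with the law of \<open>j0\<close>,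
      whose value is at least \<open>l\<close> almost surely and is therefore accepted.\<close>
    also have "(\<Prod>u<n. p u) = 0"
    proof -
      have RK: "R < K" using K by (simp add: R_def)
      have "0 < card (same_law j0)" unfolding card_gt_0_iff using l(1) by (auto simp: same_law_def)
      hence "0 < (1 - \<delta>) / K * card (same_law j0)" using K \<delta> by simp
      also have "\<dots> \<le> card (same_law j0 \<inter> \<sigma> ` phase K R)" using bal RK l(1) unfolding balanced_def by blast
      finally have "0 < card (same_law j0 \<inter> \<sigma> ` phase K R)" by simp
      hence "same_law j0 \<inter> \<sigma> ` phase K R \<noteq> {}" by (simp add: card_gt_0_iff)
      then obtain u where u: "u \<in> phase K R" "\<sigma> u \<in> same_law j0" by blast
      have "D (\<sigma> u) = D j0" using u by (intro cdf_unique real_dist) (simp add: same_law_def)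
      moreover have "accept_set K \<theta> l u = {l..}"
        using u RK K by (auto simp: accept_set_def phase_def R_def Suc_diff_Suc)
      moreover have "- {l..} = {..<l}" by auto
      ultimately have "p u = 0" using l(2) by (simp add: p_def)
      moreover have "u < n" using u phase_subset[OF RK] by auto
      ultimately show ?thesis by (intro prod_zero) auto
    qed
    finally have "(\<Sum>t<n. (\<Prod>u<t. p u) * r t) = 1" by simp
    moreover have "\<beta> * (1 - max_cdf x) \<le> 1 * 1"
      using \<beta> max_cdf_nonneg[of x] max_cdf_le_1[of x] by (intro mult_mono) auto
    ultimately show ?thesis by simp
  next
    case False
    hence lx: "l \<le> x" by simp
    \<comment> \<open>\<open>R\<close> is the default when \<open>x\<close> lies below all
      thresholds.\<close>
    define s where "s = (LEAST i. i = R \<or> \<theta> i \<le> x)"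
    have s: "s = R \<or> \<theta> s \<le> x" unfolding s_def by (rule LeastI[of _ R]) simp
    have sR: "s \<le> R" unfolding s_def by (rule Least_le) simp
    have below: "x < \<theta> i" if "i < s" for i using not_less_Least[OF that[unfolded s_def]] by auto
    \<comment> \<open>Levels increase with the phase, so once \<open>max_cdf x\<close> has reached
      the quantile of phase \<open>s\<close> it has reached all later ones too.\<close>
    have above: "\<theta> i \<le> x" if "s \<le> i" "i < R" for i
    proof (rule ccontr)
      assume "\<not> \<theta> i \<le> x"
      hence "max_cdf x < exp (- level a K i)" using \<theta>(2)[of i x] that by (auto simp: R_def)
      also have "\<dots> \<le> exp (- level a K s)" using level_mono[OF a(1,2) that(1)] that by (simp add: R_def)
      also have "\<dots> \<le> max_cdf (\<theta> s)" using \<theta>(1)[of s] that by (simp add: R_def)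
      also have "\<dots> \<le> max_cdf x" using s that by (intro monoD[OF max_cdf_mono]) auto
      finally show False by simp
    qed
    have r_phase: "r t = measure (D (\<sigma> t)) ({\<theta> i<..} \<inter> {x<..})" if "i < R" "t \<in> phase K i" for i t
      using accept_set_phase[of i K t] that by (simp add: r_def R_def)
    have early: "r t = 1 - p t" if "t < s * L" for t
    proof -
      define i where "i = t div L"
      have i: "i < s" unfolding i_def using that by (simp add: less_mult_imp_div_less)
      have "0 < L" using that by (cases L) auto
      hence "t \<in> phase K i" unfolding phase_def L_def[symmetric] i_def
        using div_times_less_eq_dividend[of t L] dividend_less_div_times[of L t] by auto
      hence "r t = measure (D (\<sigma> t)) ({\<theta> i<..} \<inter> {x<..})" "p t = cdf (D (\<sigma> t)) (\<theta> i)"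
        using i sR r_phase[of i t] p_phase[of i t] by auto
      moreover have "{\<theta> i<..} \<inter> {x<..} = - {..\<theta> i}" using below[OF i] by auto
      ultimately show ?thesis using compl[of "{..\<theta> i}"] by (simp add: cdf_def)
    qed
    \<comment> \<open>For \<open>x \<ge> l\<close> the last phase is simply dropped.\<close>
    have trunc: "(\<Sum>t<R * L. (\<Prod>u<t. p u) * r t) \<le> (\<Sum>t<n. (\<Prod>u<t. p u) * r t)"
      using RL p01 r0 by (intro sum_mono2) (auto intro!: mult_nonneg_nonneg prod_nonneg)
    have chunks: "1 - S s + \<omega> * (\<Sum>i\<in>{s..<R}. S (Suc i)) \<le> (\<Sum>t<n. (\<Prod>u<t. p u) * r t)"
      if "\<And>i. s \<le> i \<Longrightarrow> i < R \<Longrightarrow> \<omega> \<le> (\<Sum>t\<in>phase K i. r t)" for \<omega>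
      using sum_stopping_chunks_ge[OF p01 r0 early _ sR, where \<omega> = \<omega>] that trunc
      unfolding S_def phase_def L_def[symmetric] by fastforce
    have Ss: "S s \<le> exp (- ((1 - \<delta>) / K * (\<Sum>j<s. level a K j)))"
      using sR below lx by (intro Sle) (auto intro: le_less_trans)
    have F01: "0 \<le> 1 - max_cdf x" "1 - max_cdf x \<le> 1" using max_cdf_nonneg[of x] max_cdf_le_1[of x] by auto
    show ?thesis
    proof (cases "s = R")
      case True
      have "\<beta> * (1 - max_cdf x) \<le> \<beta> * 1" using \<beta> F01 by (intro mult_left_mono) auto
      also have "\<beta> * 1 \<le> (1 - \<delta>) * (1 - cos a - a / K)" using \<beta> by simp
      also have "\<dots> \<le> 1 - S s"
        using Ss a K \<delta> unfolding True R_def by (intro final_phase_value_ge) auto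
      also have "\<dots> \<le> (\<Sum>t<n. (\<Prod>u<t. p u) * r t)" using chunks[of 0] True by simp
      finally show ?thesis .
    next
      case False
      hence sR': "s < R" using sR by simp
      define \<Lambda> where "\<Lambda> = - ln (max_cdf x)"
      have "exp (- level a K s) \<le> max_cdf (\<theta> s)" using \<theta>(1)[of s] sR' by (simp add: R_def)
      also have "\<dots> \<le> max_cdf x" using s False by (intro monoD[OF max_cdf_mono]) auto
      finally have ge: "exp (- level a K s) \<le> max_cdf x" .
      hence Fx: "0 < max_cdf x" using less_le_trans[OF exp_gt_zero] by blast
      have "ln (exp (- level a K s)) \<le> ln (max_cdf x)" using ge Fx by (subst ln_le_cancel_iff) auto
      hence \<Lambda>: "0 \<le> \<Lambda>" "\<Lambda> \<le> level a K s" using Fx max_cdf_le_1[of x] by (auto simp: \<Lambda>_def ln_le_zero_iff)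
      define \<omega> where "\<omega> = 1 - exp (- ((1 - \<delta>) / K * \<Lambda>))"
      have late: "\<omega> \<le> (\<Sum>t\<in>phase K i. r t)" if i: "s \<le> i" "i < R" for i
      proof -
        have iK: "i < K" using i by (simp add: R_def)
        have "\<omega> \<le> 1 - (\<Prod>t\<in>phase K i. cdf (D (\<sigma> t)) x)"
          unfolding \<omega>_def \<Lambda>_def using phase_prod_bounds(1)[OF \<sigma> bal iK \<delta>(1) Fx] by simp
        also have "\<dots> \<le> (\<Sum>t\<in>phase K i. 1 - cdf (D (\<sigma> t)) x)"
          by (intro one_minus_prod_le_sum finite_phase) (auto intro: dist.cdf_nonneg dist.cdf_bounded_prob)
        also have "\<dots> = (\<Sum>t\<in>phase K i. r t)"
        proof (rule sum.cong[OF refl])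
          fix t assume "t \<in> phase K i"
          moreover have "{\<theta> i<..} \<inter> {x<..} = - {..x}" using above[OF i] by auto
          ultimately show "1 - cdf (D (\<sigma> t)) x = r t"
            using r_phase[OF i(2), of t] compl[of "{..x}"] by (simp add: cdf_def)
        qed
        finally show ?thesis .
      qed
      have "\<beta> * (1 - max_cdf x) \<le> (1 - \<delta>) * (1 - a * tan a / K) * exp (K * \<delta> * ln (cos a))
          * (1 - cos a - exp (a * tan a) / K) * (1 - exp (- \<Lambda>))"
        using \<beta> F01 Fx by (simp add: \<Lambda>_def mult_right_mono)
      also have "\<dots> \<le> 1 - S s + \<omega> * (\<Sum>i\<in>{s..<K - 1}. S (Suc i))"
        using a K \<delta> \<Lambda> sR' Ss Sge by (intro phase_value_ge) (auto simp: R_def \<omega>_def)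
      also have "\<dots> \<le> (\<Sum>t<n. (\<Prod>u<t. p u) * r t)" using chunks[OF late] by (simp add: R_def)
      finally show ?thesis .
    qed
  qed
  thus ?thesis by (simp add: p_def r_def)
qed

end

section \<open>Expectations over the values\<close>

text \<open>Fubini for the region under the graph. Restricting to \<open>x \<ge> 0\<close> matches
  \<open>ennreal\<close>, which sends negative values to 0.\<close>

lemma nn_integral_layer_cake:
  assumes "sigma_finite_measure M" and f [measurable]: "f \<in> borel_measurable M"
  shows "(\<integral>\<^sup>+\<omega>. ennreal (f \<omega>) \<partial>M) =
    (\<integral>\<^sup>+x. indicator {0..} x * emeasure M {\<omega> \<in> space M. x < f \<omega>} \<partial>lborel)"
proof -
  interpret M: sigma_finite_measure M by fact
  interpret pair_sigma_finite M lborel ..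
  have "(\<integral>\<^sup>+\<omega>. ennreal (f \<omega>) \<partial>M) = (\<integral>\<^sup>+\<omega>. (\<integral>\<^sup>+x. indicator {0..<f \<omega>} x \<partial>lborel) \<partial>M)"
  proof (rule nn_integral_cong)
    fix \<omega>
    show "ennreal (f \<omega>) = (\<integral>\<^sup>+x. indicator {0..<f \<omega>} x \<partial>lborel)"
      by (cases "0 \<le> f \<omega>") (auto simp: ennreal_neg)
  qed
  also have "\<dots> = (\<integral>\<^sup>+\<omega>. (\<integral>\<^sup>+x. (if 0 \<le> x \<and> x < f \<omega> then 1 else 0) \<partial>lborel) \<partial>M)"
    by (intro nn_integral_cong) (auto simp: indicator_def)
  also have "\<dots> = (\<integral>\<^sup>+x. (\<integral>\<^sup>+\<omega>. (if 0 \<le> x \<and> x < f \<omega> then 1 else 0) \<partial>M) \<partial>lborel)"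
    by (intro Fubini'[symmetric]) simp
  also have "\<dots> = (\<integral>\<^sup>+x. indicator {0..} x * emeasure M {\<omega> \<in> space M. x < f \<omega>} \<partial>lborel)"
  proof (rule nn_integral_cong)
    fix x :: real
    have "(\<integral>\<^sup>+\<omega>. (if 0 \<le> x \<and> x < f \<omega> then 1 else 0) \<partial>M) =
        (\<integral>\<^sup>+\<omega>. indicator {0..} x * indicator {\<omega> \<in> space M. x < f \<omega>} \<omega> \<partial>M)"
      by (intro nn_integral_cong) (auto simp: indicator_def)
    also have "\<dots> = indicator {0..} x * emeasure M {\<omega> \<in> space M. x < f \<omega>}"
      by (subst nn_integral_cmult) auto
    finally show "(\<integral>\<^sup>+\<omega>. (if 0 \<le> x \<and> x < f \<omega> then 1 else 0) \<partial>M) =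
        indicator {0..} x * emeasure M {\<omega> \<in> space M. x < f \<omega>}" .
  qed
  finally show ?thesis .
qed

section \<open>The accepted value as a random variable\<close>

lemma accepted_value_first:
  assumes "t < n" "v t \<in> B t" "\<And>u. u < t \<Longrightarrow> v u \<notin> B u"
  shows "accepted_value (\<lambda>t h. h t \<in> B t) n v = v t"
proof -
  have "(LEAST t. v t \<in> B t) = t"
    using assms by (intro Least_equality) (auto simp: not_less[symmetric])
  thus ?thesis using assms by (auto simp: accepted_value_def)
qed

text \<open>The condition can hold for one \<open>t\<close> at most, so the \<open>LEAST\<close>
  operator becomes a finite sum, whose measurability can be checked term by term.\<close>

lemma accepted_value_eq_sum:
  "accepted_value (\<lambda>t h. h t \<in> B t) n v =
    (\<Sum>t<n. if v t \<in> B t \<and> (\<forall>u\<in>{..<t}. v u \<notin> B u) then v t else 0)"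
proof (cases "\<exists>t<n. v t \<in> B t")
  case True
  define T where "T = (LEAST t. v t \<in> B t)"
  have T: "v T \<in> B T" "\<And>u. u < T \<Longrightarrow> v u \<notin> B u"
    using True unfolding T_def by (auto intro: LeastI dest: not_less_Least)
  have Tn: "T < n" using True Least_le[of "\<lambda>t. v t \<in> B t"] unfolding T_def by (meson le_less_trans)
  have only: "t = T" if "v t \<in> B t" "\<forall>u\<in>{..<t}. v u \<notin> B u" for t
  proof (cases t T rule: linorder_cases)
    case less
    thus ?thesis using T(2)[of t] that(1) by simp
  next
    case greater
    thus ?thesis using T(1) that(2) by simp
  qed
  have "(\<Sum>t<n. if v t \<in> B t \<and> (\<forall>u\<in>{..<t}. v u \<notin> B u) then v t else 0) = (\<Sum>t<n. if t = T then v t else 0)"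
  proof (rule sum.cong[OF refl])
    fix t
    show "(if v t \<in> B t \<and> (\<forall>u\<in>{..<t}. v u \<notin> B u) then v t else 0) = (if t = T then v t else 0)"
    proof (cases "t = T")
      case True
      thus ?thesis using T by simp
    next
      case False
      hence "\<not> (v t \<in> B t \<and> (\<forall>u\<in>{..<t}. v u \<notin> B u))" using only[of t] by blast
      thus ?thesis using False by (simp only: if_False)
    qed
  qed
  also have "\<dots> = v T" using Tn by (simp add: sum.delta)
  finally show ?thesis using accepted_value_first[of T n v B, OF Tn T] by simp
next
  case False
  hence "(\<Sum>t<n. if v t \<in> B t \<and> (\<forall>u\<in>{..<t}. v u \<notin> B u) then v t else 0) = (\<Sum>t<n. 0)"
    by (intro sum.cong refl) auto
  thus ?thesis using False by (auto simp: accepted_value_def)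
qed

context items
begin

abbreviation "P \<equiv> Pi\<^sub>M {..<n} D"

lemma measurable_item:
  assumes "i < n"
  shows "(\<lambda>\<omega>. \<omega> i) \<in> borel_measurable P"
proof -
  have "(\<lambda>\<omega>. \<omega> i) \<in> measurable P (D i)" using assms by (intro measurable_component_singleton) simp
  thus ?thesis using measurable_cong_sets[OF refl dist.events_eq_borel[of i]] by blast
qed

lemma emeasure_first_accept:
  assumes \<sigma>: "\<sigma> permutes {..<n}" and B: "\<And>t. B t \<in> sets borel" and t: "t < n"
  shows "emeasure P {\<omega> \<in> space P. (\<forall>u<t. \<omega> (\<sigma> u) \<notin> B u) \<and> \<omega> (\<sigma> t) \<in> B t \<and> x < \<omega> (\<sigma> t)} =
    ennreal ((\<Prod>u<t. measure (D (\<sigma> u)) (- B u)) * measure (D (\<sigma> t)) (B t \<inter> {x<..}))"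
proof -
  define Y where "Y u = (if u < t then - B u else B t \<inter> {x<..})" for u
  \<comment> \<open>The constraints are indexed by time and the product measure by items;
    \<open>inv \<sigma>\<close> translates, so that the event becomes a cylinder set.\<close>
  define X where "X i = Y (inv \<sigma> i)" for i
  have X: "X (\<sigma> u) = Y u" for u unfolding X_def using permutes_inverses(2)[OF \<sigma>] by simp
  have Yb: "Y u \<in> sets borel" for u using B by (auto simp: Y_def)
  have split: "{..t} = insert t {..<t}" by auto
  have "{\<omega> \<in> space P. (\<forall>u<t. \<omega> (\<sigma> u) \<notin> B u) \<and> \<omega> (\<sigma> t) \<in> B t \<and> x < \<omega> (\<sigma> t)} =
      {\<omega> \<in> space P. \<forall>i\<in>\<sigma> ` {..t}. \<omega> i \<in> X i}"
    unfolding split by (auto simp: X Y_def)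
  also have "emeasure P \<dots> = (\<Prod>i\<in>\<sigma> ` {..t}. emeasure (D i) (X i))"
  proof (rule emeasure_PiM_Collect)
    show "\<sigma> ` {..t} \<subseteq> {..<n}"
    proof (rule image_subsetI)
      fix u assume "u \<in> {..t}"
      hence "u \<in> {..<n}" using t by simp
      thus "\<sigma> u \<in> {..<n}" by (simp only: permutes_in_image[OF \<sigma>])
    qed
  qed (simp_all add: X_def Yb)
  also have "\<dots> = (\<Prod>u\<in>{..t}. emeasure (D (\<sigma> u)) (Y u))"
    using permutes_inj_on[OF \<sigma>] by (simp add: prod.reindex X)
  also have "\<dots> = (\<Prod>u\<in>{..t}. ennreal (measure (D (\<sigma> u)) (Y u)))"
    by (intro prod.cong refl dist.emeasure_eq_measure)
  also have "\<dots> = ennreal (\<Prod>u\<in>{..t}. measure (D (\<sigma> u)) (Y u))" by (simp add: prod_ennreal)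
  also have "(\<Prod>u\<in>{..t}. measure (D (\<sigma> u)) (Y u)) = (\<Prod>u<t. measure (D (\<sigma> u)) (- B u)) * measure (D (\<sigma> t)) (B t \<inter> {x<..})"
    unfolding split by (simp add: Y_def mult.commute)
  finally show ?thesis .
qed

lemma measurable_accepted_value:
  assumes \<sigma>: "\<sigma> permutes {..<n}" and B: "\<And>t. B t \<in> sets borel"
  shows "(\<lambda>\<omega>. accepted_value (\<lambda>t h. h t \<in> B t) n (\<lambda>t. \<omega> (\<sigma> t))) \<in> borel_measurable P"
  unfolding accepted_value_eq_sum
proof (intro borel_measurable_sum measurable_If)
  fix t assume "t \<in> {..<n}"
  hence m: "(\<lambda>\<omega>. \<omega> (\<sigma> u)) \<in> borel_measurable P" if "u \<le> t" for u
    using that permutes_in_image[OF \<sigma>, of u] by (intro measurable_item) auto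
  show "(\<lambda>\<omega>. \<omega> (\<sigma> t)) \<in> borel_measurable P" by (rule m) simp
  have "{\<omega> \<in> space P. \<omega> (\<sigma> u) \<in> B u} \<in> sets P" if "u \<le> t" for u
    using measurable_sets[OF m[OF that] B[of u]] by (simp add: vimage_def Int_def conj_commute)
  hence pm: "Measurable.pred P (\<lambda>\<omega>. \<omega> (\<sigma> u) \<in> B u)" if "u \<le> t" for u
    using that by (auto simp: pred_def)
  show "{\<omega> \<in> space P. \<omega> (\<sigma> t) \<in> B t \<and> (\<forall>u\<in>{..<t}. \<omega> (\<sigma> u) \<notin> B u)} \<in> sets P"
    unfolding pred_def[symmetric] using pm by (intro pred_intros_logic pred_intros_finite) auto
qed simp

text \<open>The events of stopping at different times are disjoint. Equality can fail for
  \<open>x < 0\<close>, where the value 0 of accepting nothing also exceeds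
  \<open>x\<close>.\<close>

lemma prob_accepted_value_ge:
  assumes \<sigma>: "\<sigma> permutes {..<n}" and B: "\<And>t. B t \<in> sets borel"
  shows "ennreal (\<Sum>t<n. (\<Prod>u<t. measure (D (\<sigma> u)) (- B u)) * measure (D (\<sigma> t)) (B t \<inter> {x<..})) \<le>
    emeasure P {\<omega> \<in> space P. x < accepted_value (\<lambda>t h. h t \<in> B t) n (\<lambda>t. \<omega> (\<sigma> t))}"
proof -
  define E where "E t = {\<omega> \<in> space P. (\<forall>u<t. \<omega> (\<sigma> u) \<notin> B u) \<and> \<omega> (\<sigma> t) \<in> B t \<and> x < \<omega> (\<sigma> t)}" for t
  have mE: "E t \<in> sets P" if "t < n" for t
  proof -
    have m: "(\<lambda>\<omega>. \<omega> (\<sigma> u)) \<in> borel_measurable P" if "u \<le> t" for u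
      using that \<open>t < n\<close> permutes_in_image[OF \<sigma>, of u] by (intro measurable_item) auto
    have "{\<omega> \<in> space P. \<omega> (\<sigma> u) \<in> Z} \<in> sets P" if "u \<le> t" "Z \<in> sets borel" for u Z
      using measurable_sets[OF m[OF that(1)] that(2)] by (simp add: vimage_def Int_def conj_commute)
    hence pm: "Measurable.pred P (\<lambda>\<omega>. \<omega> (\<sigma> u) \<in> Z)" if "u \<le> t" "Z \<in> sets borel" for u Z
      using that by (auto simp: pred_def)
    have "E t = {\<omega> \<in> space P. (\<forall>u\<in>{..<t}. \<omega> (\<sigma> u) \<in> - B u) \<and> \<omega> (\<sigma> t) \<in> B t \<inter> {x<..}}"
      by (auto simp: E_def)
    also have "\<dots> \<in> sets P"
      unfolding pred_def[symmetric] using B by (intro pred_intros_logic pred_intros_finite pm) auto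
    finally show ?thesis .
  qed
  have "ennreal (\<Sum>t<n. (\<Prod>u<t. measure (D (\<sigma> u)) (- B u)) * measure (D (\<sigma> t)) (B t \<inter> {x<..})) =
      (\<Sum>t<n. ennreal ((\<Prod>u<t. measure (D (\<sigma> u)) (- B u)) * measure (D (\<sigma> t)) (B t \<inter> {x<..})))"
    by (intro sum_ennreal[symmetric] mult_nonneg_nonneg prod_nonneg) auto
  also have "\<dots> = (\<Sum>t<n. emeasure P (E t))"
    unfolding E_def by (intro sum.cong refl emeasure_first_accept[OF \<sigma> B, symmetric]) simp
  also have "\<dots> = emeasure P (\<Union>t<n. E t)"
  proof (rule sum_emeasure)
    show "disjoint_family_on E {..<n}"
      unfolding disjoint_family_on_def
    proof (intro ballI impI)
      fix s t :: nat assume "s \<noteq> t"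
      thus "E s \<inter> E t = {}" by (induction s t rule: linorder_wlog) (auto simp: E_def)
    qed
  qed (use mE in auto)
  also have "\<dots> \<le> emeasure P {\<omega> \<in> space P. x < accepted_value (\<lambda>t h. h t \<in> B t) n (\<lambda>t. \<omega> (\<sigma> t))}"
  proof (rule emeasure_mono)
    show "(\<Union>t<n. E t) \<subseteq> {\<omega> \<in> space P. x < accepted_value (\<lambda>t h. h t \<in> B t) n (\<lambda>t. \<omega> (\<sigma> t))}"
    proof
      fix \<omega> assume "\<omega> \<in> (\<Union>t<n. E t)"
      then obtain t where t: "t < n" "\<omega> \<in> E t" by auto
      have "accepted_value (\<lambda>t h. h t \<in> B t) n (\<lambda>t. \<omega> (\<sigma> t)) = \<omega> (\<sigma> t)"
        using t by (intro accepted_value_first) (auto simp: E_def)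
      thus "\<omega> \<in> {\<omega> \<in> space P. x < accepted_value (\<lambda>t h. h t \<in> B t) n (\<lambda>t. \<omega> (\<sigma> t))}"
        using t by (simp add: E_def)
    qed
    show "{\<omega> \<in> space P. x < accepted_value (\<lambda>t h. h t \<in> B t) n (\<lambda>t. \<omega> (\<sigma> t))} \<in> sets P"
      using measurable_accepted_value[OF \<sigma> B] by measurable
  qed
  finally show ?thesis .
qed

lemma measurable_max: "(\<lambda>\<omega>. Max (\<omega> ` {..<n})) \<in> borel_measurable P"
  by (intro borel_measurable_Max measurable_item) auto

lemma prob_max: "emeasure P {\<omega> \<in> space P. x < Max (\<omega> ` {..<n})} = ennreal (1 - max_cdf x)"
proof -
  have gr: "x < Max (\<omega> ` {..<n}) \<longleftrightarrow> \<not> (\<forall>i\<in>{..<n}. \<omega> i \<in> {..x})" for \<omega> :: "nat \<Rightarrow> real"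
    using n_pos by (subst Max_gr_iff) (auto simp: not_le lessThan_empty_iff)
  have "{\<omega> \<in> space P. x < Max (\<omega> ` {..<n})} = space P - {\<omega> \<in> space P. \<forall>i\<in>{..<n}. \<omega> i \<in> {..x}}"
    unfolding gr by blast
  moreover have "{\<omega> \<in> space P. \<forall>i\<in>{..<n}. \<omega> i \<in> {..x}} \<in> sets P"
  proof -
    have "{\<omega> \<in> space P. \<forall>i\<in>{..<n}. \<omega> i \<in> {..x}} = space P - {\<omega> \<in> space P. x < Max (\<omega> ` {..<n})}"
      unfolding gr by blast
    moreover have "{\<omega> \<in> space P. x < Max (\<omega> ` {..<n})} \<in> sets P"
      using measurable_max unfolding borel_measurable_iff_greater by (rule spec)
    ultimately show ?thesis by (simp only: sets.compl_sets)
  qed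
  moreover have "emeasure P {\<omega> \<in> space P. \<forall>i\<in>{..<n}. \<omega> i \<in> {..x}} = (\<Prod>i<n. emeasure (D i) {..x})"
    by (rule emeasure_PiM_Collect) auto
  moreover have "(\<Prod>i<n. emeasure (D i) {..x}) = (\<Prod>i<n. ennreal (cdf (D i) x))"
    by (intro prod.cong refl) (simp add: dist.emeasure_eq_measure cdf_def)
  moreover have "\<dots> = ennreal (max_cdf x)"
    unfolding max_cdf_def by (intro prod_ennreal) (auto intro: dist.cdf_nonneg)
  ultimately show ?thesis
    using max_cdf_nonneg[of x] by (simp add: emeasure_compl emeasure_space_1 ennreal_minus flip: ennreal_1)
qed

text \<open>The comparison of tails is integrated over \<open>x \<ge> 0\<close> by the layer cake
  formula, applied to both the maximum and the accepted value.\<close>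

lemma accepted_value_expectation_ge:
  assumes \<sigma>: "\<sigma> permutes {..<n}" and B: "\<And>t. B t \<in> sets borel" and "0 \<le> \<beta>"
    and ge: "\<And>x. \<beta> * (1 - max_cdf x) \<le>
      (\<Sum>t<n. (\<Prod>u<t. measure (D (\<sigma> u)) (- B u)) * measure (D (\<sigma> t)) (B t \<inter> {x<..}))"
  shows "ennreal \<beta> * expected_max n D \<le>
    (\<integral>\<^sup>+\<omega>. ennreal (accepted_value (\<lambda>t h. h t \<in> B t) n (\<lambda>t. \<omega> (\<sigma> t))) \<partial>P)"
proof -
  have sf: "sigma_finite_measure P" by unfold_locales
  have meas: "(\<lambda>x. indicator {0..} x * emeasure P {\<omega> \<in> space P. x < Max (\<omega> ` {..<n})}) \<in> borel_measurable lborel"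
  proof -
    have "max_cdf \<in> borel_measurable borel" using max_cdf_mono by (rule borel_measurable_mono)
    thus ?thesis unfolding prob_max by measurable
  qed
  have "ennreal \<beta> * expected_max n D =
      (\<integral>\<^sup>+x. ennreal \<beta> * (indicator {0..} x * emeasure P {\<omega> \<in> space P. x < Max (\<omega> ` {..<n})}) \<partial>lborel)"
    unfolding expected_max_def nn_integral_layer_cake[OF sf measurable_max]
    using meas by (simp add: nn_integral_cmult)
  also have "\<dots> \<le> (\<integral>\<^sup>+x. indicator {0..} x *
      emeasure P {\<omega> \<in> space P. x < accepted_value (\<lambda>t h. h t \<in> B t) n (\<lambda>t. \<omega> (\<sigma> t))} \<partial>lborel)"
  proof (rule nn_integral_mono)
    fix x :: real
    have "ennreal \<beta> * emeasure P {\<omega> \<in> space P. x < Max (\<omega> ` {..<n})} = ennreal (\<beta> * (1 - max_cdf x))"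
      unfolding prob_max using \<open>0 \<le> \<beta>\<close> by (simp add: ennreal_mult')
    also have "\<dots> \<le> ennreal (\<Sum>t<n. (\<Prod>u<t. measure (D (\<sigma> u)) (- B u)) * measure (D (\<sigma> t)) (B t \<inter> {x<..}))"
      by (rule ennreal_leI[OF ge])
    also have "\<dots> \<le> emeasure P {\<omega> \<in> space P. x < accepted_value (\<lambda>t h. h t \<in> B t) n (\<lambda>t. \<omega> (\<sigma> t))}"
      by (rule prob_accepted_value_ge[OF \<sigma> B])
    finally have "indicator {0..} x * (ennreal \<beta> * emeasure P {\<omega> \<in> space P. x < Max (\<omega> ` {..<n})}) \<le>
        indicator {0..} x * emeasure P {\<omega> \<in> space P. x < accepted_value (\<lambda>t h. h t \<in> B t) n (\<lambda>t. \<omega> (\<sigma> t))}"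
      by (intro mult_left_mono) auto
    thus "ennreal \<beta> * (indicator {0..} x * emeasure P {\<omega> \<in> space P. x < Max (\<omega> ` {..<n})}) \<le>
        indicator {0..} x * emeasure P {\<omega> \<in> space P. x < accepted_value (\<lambda>t h. h t \<in> B t) n (\<lambda>t. \<omega> (\<sigma> t))}"
      by (simp add: mult_ac)
  qed
  also have "\<dots> = (\<integral>\<^sup>+\<omega>. ennreal (accepted_value (\<lambda>t h. h t \<in> B t) n (\<lambda>t. \<omega> (\<sigma> t))) \<partial>P)"
    by (rule nn_integral_layer_cake[OF sf measurable_accepted_value[OF \<sigma> B], symmetric])
  finally show ?thesis .
qed

end

section \<open>Random orders\<close>

text \<open>A union bound over the \<open>K\<close> phases and \<open>n\<close> items, with the
  Chernoff bound for each pair.\<close>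

lemma (in items) card_unbalanced_le:
  fixes \<delta> :: real and K m :: nat
  assumes K: "2 \<le> K" and \<delta>: "0 < \<delta>" "\<delta> < 1"
    and m: "\<And>j. j < n \<Longrightarrow> m \<le> card (same_law j)" and n: "2 * real K / \<delta> \<le> real n"
  shows "card {\<sigma>. \<sigma> permutes {..<n} \<and> \<not> balanced K \<delta> \<sigma>} \<le> real K * real n * exp (- ((\<delta> / K)\<^sup>2 / 16) * real m) * fact n"
proof -
  define d where "d = \<delta> / K"
  define q where "q = 1 / real K"
  define X where "X i j = {\<sigma>. \<sigma> permutes {..<n} \<and> card (same_law j \<inter> \<sigma> ` phase K i) < (q - d) * card (same_law j)}" for i j
  have K0: "0 < real K" using K by simp
  have qd: "q - d = (1 - \<delta>) / K" by (simp add: q_def d_def diff_divide_distrib)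
  have fin: "finite (X i j)" for i j
    by (rule finite_subset[OF _ finite_permutations[of "{..<n}"]]) (auto simp: X_def)
  have each: "real (card (X i j)) \<le> exp (- (d\<^sup>2 / 16) * m) * fact n" if "i < K" "j < n" for i j
  proof -
    have "n < Suc (n div K) * K" using K by (simp add: dividend_less_div_times)
    hence "real n < real (Suc (n div K) * K)" by (simp only: of_nat_less_iff)
    hence "real n / K < real (n div K) + 1" using K0 by (simp add: pos_divide_less_eq algebra_simps)
    \<comment> \<open>Rounding the phase length down loses less than 1, which the slack
      \<open>d / 2\<close> of the Chernoff bound covers.\<close>
    moreover have "1 \<le> d / 2 * n" using n \<delta> K0 by (simp add: d_def field_simps)
    ultimately have "(q - d / 2) * n \<le> real (n div K)" by (simp add: q_def left_diff_distrib)
    hence "real (card (X i j)) \<le> exp (- (d\<^sup>2 / 16) * card (same_law j)) * fact (card {..<n})"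
      unfolding X_def
    proof (intro card_permutes_deficit_le)
      show "phase K i \<subseteq> {..<n}" by (rule phase_subset[OF that(1)])
      show "same_law j \<subseteq> {..<n}" by (auto simp: same_law_def)
      show "0 < d" "d \<le> q" "q \<le> 1" using \<delta> K by (auto simp: d_def q_def divide_right_mono)
      show "{..<n} \<noteq> {}" using n_pos by auto
    qed (auto simp: phase_def)
    also have "\<dots> \<le> exp (- (d\<^sup>2 / 16) * m) * fact n"
    proof -
      have "d\<^sup>2 / 16 * real m \<le> d\<^sup>2 / 16 * real (card (same_law j))"
        using m[OF that(2)] by (intro mult_left_mono) auto
      thus ?thesis by (simp add: mult_right_mono)
    qed
    finally show ?thesis .
  qed
  have "{\<sigma>. \<sigma> permutes {..<n} \<and> \<not> balanced K \<delta> \<sigma>} \<subseteq> (\<Union>i<K. \<Union>j<n. X i j)"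
    unfolding balanced_def X_def qd by (auto simp: not_le)
  hence "card {\<sigma>. \<sigma> permutes {..<n} \<and> \<not> balanced K \<delta> \<sigma>} \<le> card (\<Union>i<K. \<Union>j<n. X i j)"
    using fin by (intro card_mono) auto
  also have "\<dots> \<le> (\<Sum>i<K. card (\<Union>j<n. X i j))" by (intro card_UN_le) simp
  also have "\<dots> \<le> (\<Sum>i<K. \<Sum>j<n. card (X i j))" by (intro sum_mono card_UN_le) simp
  finally have "real (card {\<sigma>. \<sigma> permutes {..<n} \<and> \<not> balanced K \<delta> \<sigma>}) \<le> (\<Sum>i<K. \<Sum>j<n. real (card (X i j)))"
    by (simp only: of_nat_sum[symmetric] of_nat_le_iff)
  also have "\<dots> \<le> (\<Sum>i<K. \<Sum>j<n. exp (- (d\<^sup>2 / 16) * m) * fact n)"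
    using each by (intro sum_mono) auto
  also have "\<dots> = real K * real n * exp (- (d\<^sup>2 / 16) * real m) * fact n" by simp
  finally show ?thesis unfolding d_def .
qed

text \<open>Orders that are not good contribute at least 0 and are discarded.\<close>

lemma random_order_value_ge:
  fixes \<eta> :: real
  assumes \<eta>: "0 \<le> \<eta>" "\<eta> \<le> 1"
    and bad: "card {\<sigma>. \<sigma> permutes {..<n} \<and> \<not> good \<sigma>} \<le> \<eta> * fact n"
    and good: "\<And>\<sigma>. \<sigma> permutes {..<n} \<Longrightarrow> good \<sigma> \<Longrightarrow>
      V \<le> (\<integral>\<^sup>+x. ennreal (accepted_value A n (\<lambda>t. x (\<sigma> t))) \<partial>(Pi\<^sub>M {..<n} D))"
  shows "ennreal (1 - \<eta>) * V \<le> random_order_value A n D"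
proof -
  let ?S = "{\<sigma>. \<sigma> permutes {..<n}}"
  let ?G = "{\<sigma>. \<sigma> permutes {..<n} \<and> good \<sigma>}"
  have fin: "finite ?S" by (rule finite_permutations) simp
  have ne: "?S \<noteq> {}" using permutes_id by blast
  have cS: "card ?S = fact n" using card_permutations[of "{..<n}" n] by simp
  let ?N = "{\<sigma>. \<sigma> permutes {..<n} \<and> \<not> good \<sigma>}"
  have "card ?S = card (?G \<union> ?N)" by (rule arg_cong[where f = card]) blast
  also have "\<dots> = card ?G + card ?N"
    by (rule card_Un_disjoint) (auto intro: finite_subset[OF _ fin])
  finally have "real (fact n) = real (card ?G + card ?N)" unfolding cS by (rule arg_cong)
  hence "fact n = real (card ?G) + real (card ?N)" unfolding of_nat_add of_nat_fact .
  hence "(1 - \<eta>) * fact n \<le> card ?G" using bad by (simp add: left_diff_distrib)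
  hence "1 - \<eta> \<le> card ?G / fact n" by (simp add: pos_le_divide_eq)
  also have "\<dots> = measure (measure_pmf (pmf_of_set ?S)) ?G"
  proof -
    have "?S \<inter> ?G = ?G" by auto
    thus ?thesis using measure_pmf_of_set[OF ne fin, of ?G] cS by simp
  qed
  finally have "ennreal (1 - \<eta>) \<le> emeasure (measure_pmf (pmf_of_set ?S)) ?G"
    by (simp add: measure_pmf.emeasure_eq_measure ennreal_leI)
  hence "ennreal (1 - \<eta>) * V \<le> emeasure (measure_pmf (pmf_of_set ?S)) ?G * V" by (rule mult_right_mono) simp
  also have "\<dots> = (\<integral>\<^sup>+\<sigma>. V * indicator ?G \<sigma> \<partial>measure_pmf (pmf_of_set ?S))"
    by (simp add: nn_integral_cmult_indicator mult.commute)
  also have "\<dots> \<le> random_order_value A n D"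
    unfolding random_order_value_def using good by (intro nn_integral_mono) (auto simp: indicator_def)
  finally show ?thesis .
qed

text \<open>The constant must not depend on \<open>n\<close>. The restriction
  \<open>2 \<le> n\<close> is essential: for \<open>n = 1\<close> the logarithm vanishes and the
  hypothesis does not force \<open>m\<close> to be large.\<close>

lemma exists_frequency_constant:
  fixes \<gamma> \<epsilon> M :: real and K :: nat
  assumes "0 < \<gamma>" "0 < \<epsilon>" "\<epsilon> \<le> 1" "1 \<le> K" "0 \<le> M"
  shows "\<exists>c::real. \<forall>(n::nat) m. 2 \<le> n \<longrightarrow> c * ln (real n) \<le> m \<longrightarrow> M \<le> m \<and> real K * real n * exp (- \<gamma> * m) \<le> \<epsilon>"
proof -
  define X where "X = ln (K / \<epsilon>) / ln 2"
  have KE: "1 \<le> K / \<epsilon>" using assms by (simp add: pos_le_divide_eq)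
  hence X0: "0 \<le> X" by (auto simp: X_def)
  show ?thesis
  \<comment> \<open>The first summand yields
    \<open>\<gamma> * m \<ge> ln n + ln (K / \<epsilon>)\<close>, the second
    \<open>m \<ge> M\<close>; both use \<open>ln 2 \<le> ln n\<close>.\<close>
  proof (intro exI[of _ "(1 + X) / \<gamma> + M / ln 2"] allI impI)
  fix n :: nat and m :: real
  assume n: "2 \<le> n" and m: "((1 + X) / \<gamma> + M / ln 2) * ln n \<le> m"
  have ln2: "0 < ln (2::real)" "ln 2 \<le> ln n" using n by auto
  have t: "0 \<le> (1 + X) / \<gamma> * ln n" "0 \<le> M / ln 2 * ln n"
    using X0 assms ln2 by (intro mult_nonneg_nonneg divide_nonneg_pos; linarith)+
  have "M = M / ln 2 * ln 2" by simp
  also have "\<dots> \<le> M / ln 2 * ln n" using ln2 assms by (intro mult_left_mono) auto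
  also have "\<dots> \<le> m" using m t by (simp add: distrib_right)
  finally have "M \<le> m" .
  have "(1 + X) / \<gamma> * ln n \<le> m" using m t by (simp add: distrib_right)
  hence "\<gamma> * ((1 + X) / \<gamma> * ln n) \<le> \<gamma> * m" using assms by (intro mult_left_mono) auto
  hence "(1 + X) * ln n \<le> \<gamma> * m" using assms by simp
  moreover have "X * ln 2 \<le> X * ln n" using ln2 X0 by (intro mult_left_mono) auto
  moreover have "X * ln 2 = ln (K / \<epsilon>)" by (simp add: X_def)
  ultimately have "ln n + ln (K / \<epsilon>) \<le> \<gamma> * m" by (simp add: distrib_right)
  hence "exp (- \<gamma> * m) \<le> exp (- (ln n + ln (K / \<epsilon>)))" by simp
  also have "\<dots> = inverse (exp (ln n) * exp (ln (K / \<epsilon>)))" by (simp only: exp_minus exp_add)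
  also have "\<dots> = inverse (real n * (K / \<epsilon>))" using n KE by simp
  also have "\<dots> = \<epsilon> / (real K * real n)" by (simp add: inverse_eq_divide)
  finally have "real K * real n * exp (- \<gamma> * m) \<le> real K * real n * (\<epsilon> / (real K * real n))" by (intro mult_left_mono) auto
  also have "\<dots> = \<epsilon>" using n assms by simp
  finally show "M \<le> m \<and> real K * real n * exp (- \<gamma> * m) \<le> \<epsilon>" using \<open>M \<le> m\<close> by simp
  qed
qed

lemma single_item_value:
  "expected_max 1 D \<le> random_order_value (\<lambda>_ _. True) 1 D"
proof -
  have "ennreal (1 - 0) * expected_max 1 D \<le> random_order_value (\<lambda>_ _. True) 1 D"
  proof (rule random_order_value_ge[where good = "\<lambda>_. True"])
    fix \<sigma> :: "nat \<Rightarrow> nat" assume "\<sigma> permutes {..<1}"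
    hence \<sigma>0: "\<sigma> 0 = 0" using permutes_in_image[of \<sigma> "{..<1}" 0] by simp
    have "accepted_value (\<lambda>_ _. True) 1 v = v 0" for v
      by (simp add: accepted_value_def Least_eq_0)
    moreover have "{..<1} = {0::nat}" by auto
    ultimately show "expected_max 1 D \<le> (\<integral>\<^sup>+x. ennreal (accepted_value (\<lambda>_ _. True) 1 (\<lambda>t. x (\<sigma> t))) \<partial>Pi\<^sub>M {..<1} D)"
      by (simp add: expected_max_def \<sigma>0)
  qed simp_all
  thus ?thesis by simp
qed

text \<open>The thresholds depend on \<open>max_cdf\<close> alone, so one rule serves all orders;
  the loss \<open>\<epsilon>\<close> from unbalanced orders multiplies the ratio
  \<open>\<beta>\<close> on balanced ones.\<close>

lemma (in items) exists_threshold_algorithm: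
  fixes a \<epsilon> \<delta> :: real and K m :: nat
  assumes a: "0 < a" "a < pi / 2" "cos a + sin a / a - 1 = 0"
    and \<epsilon>: "0 \<le> \<epsilon>" "\<epsilon> \<le> 1"
    and K: "2 \<le> K" "a * tan a \<le> K" and \<delta>: "0 < \<delta>" "\<delta> < 1"
    and \<beta>: "0 \<le> \<beta>" "\<beta> \<le> 1"
      "\<beta> \<le> (1 - \<delta>) * (1 - a * tan a / K) * exp (K * \<delta> * ln (cos a)) * (1 - cos a - exp (a * tan a) / K)"
      "\<beta> \<le> (1 - \<delta>) * (1 - cos a - a / K)"
    and m: "\<And>j. j < n \<Longrightarrow> m \<le> card (same_law j)" "2 * real K / \<delta> \<le> real m"
      "real K * real n * exp (- ((\<delta> / K)\<^sup>2 / 16) * real m) \<le> \<epsilon>"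
  shows "\<exists>A. online_algorithm A \<and> ennreal ((1 - \<epsilon>) * \<beta>) * expected_max n D \<le> random_order_value A n D"
proof -
  obtain l j0 where l: "j0 < n" "measure (D j0) {..<l} = 0" "\<And>y. l < y \<Longrightarrow> isCont max_cdf y"
    by (rule max_left_end) blast
  define Q where "Q i y \<longleftrightarrow> exp (- level a K i) \<le> max_cdf y \<and> (\<forall>z<y. max_cdf z < exp (- level a K i)) \<and>
      (isCont max_cdf y \<longrightarrow> max_cdf y = exp (- level a K i))" for i y
  define \<theta> where "\<theta> i = (SOME y. Q i y)" for i
  have Q\<theta>: "Q i (\<theta> i)" if "i < K - 1" for i
  proof -
    have "0 < level a K i" using a that by (intro level_pos) auto
    hence q: "0 < exp (- level a K i)" "exp (- level a K i) < 1" by auto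
    obtain y where "0 \<le> y" "exp (- level a K i) \<le> max_cdf y" "\<And>z. z < y \<Longrightarrow> max_cdf z < exp (- level a K i)"
      "isCont max_cdf y \<Longrightarrow> max_cdf y = exp (- level a K i)"
      by (rule max_cdf_quantile[OF q]) (rule that)
    hence "Q i y" unfolding Q_def by blast
    thus ?thesis unfolding \<theta>_def by (rule someI)
  qed
  have \<theta>: "\<And>i. i < K - 1 \<Longrightarrow> exp (- level a K i) \<le> max_cdf (\<theta> i)"
      "\<And>i y. i < K - 1 \<Longrightarrow> y < \<theta> i \<Longrightarrow> max_cdf y < exp (- level a K i)"
      "\<And>i. i < K - 1 \<Longrightarrow> isCont max_cdf (\<theta> i) \<Longrightarrow> max_cdf (\<theta> i) = exp (- level a K i)"
    using Q\<theta> unfolding Q_def by blast+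
  define A where "A t h \<longleftrightarrow> h t \<in> accept_set K \<theta> l t" for t and h :: "nat \<Rightarrow> real"
  have A: "A = (\<lambda>t h. h t \<in> accept_set K \<theta> l t)" by (intro ext) (simp add: A_def)
  have "online_algorithm A"
    unfolding online_algorithm_def A
  proof
    fix t :: nat
    have "(\<lambda>h. h t) \<in> borel_measurable (Pi\<^sub>M {..t} (\<lambda>_. borel :: real measure))"
      by (rule measurable_component_singleton) simp
    thus "Measurable.pred (Pi\<^sub>M {..t} (\<lambda>_. borel)) (\<lambda>h. h t \<in> accept_set K \<theta> l t)"
      by (rule pred_sets2[OF accept_set_borel])
  qed
  moreover have "ennreal (1 - \<epsilon>) * (ennreal \<beta> * expected_max n D) \<le> random_order_value A n D"
  proof (rule random_order_value_ge[OF \<epsilon>, where good = "balanced K \<delta>"])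
    have "m \<le> card (same_law 0)" using m(1) n_pos by blast
    also have "\<dots> \<le> card {..<n}" by (intro card_mono) (auto simp: same_law_def)
    finally have "2 * real K / \<delta> \<le> real n" using m(2) by simp
    hence "card {\<sigma>. \<sigma> permutes {..<n} \<and> \<not> balanced K \<delta> \<sigma>} \<le> real K * real n * exp (- ((\<delta> / K)\<^sup>2 / 16) * real m) * fact n"
      using card_unbalanced_le[OF K(1) \<delta> m(1)] by simp
    also have "\<dots> \<le> \<epsilon> * fact n" using m(3) by (intro mult_right_mono) auto
    finally show "card {\<sigma>. \<sigma> permutes {..<n} \<and> \<not> balanced K \<delta> \<sigma>} \<le> \<epsilon> * fact n" .
    fix \<sigma> assume \<sigma>: "\<sigma> permutes {..<n}" "balanced K \<delta> \<sigma>"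
    show "ennreal \<beta> * expected_max n D \<le> (\<integral>\<^sup>+x. ennreal (accepted_value A n (\<lambda>t. x (\<sigma> t))) \<partial>P)"
      unfolding A
      by (rule accepted_value_expectation_ge[OF \<sigma>(1) accept_set_borel \<beta>(1)])
        (rule order_value_ge[OF a K \<delta> \<beta> \<sigma> l \<theta>])
  qed
  ultimately show ?thesis using \<epsilon> \<beta> by (intro exI[of _ A]) (simp add: ennreal_mult mult.assoc)
qed

theorem theorem8:
  fixes a \<alpha> \<epsilon> :: real
  assumes "0 < a" and "a < pi / 2" and "cos a + sin a / a - 1 = 0"
    and "\<alpha> = 1 - cos a"
    and "\<epsilon> > 0"
  shows "\<exists>c::real. \<forall>n\<ge>1. \<forall>D :: nat \<Rightarrow> real measure. \<forall>m::nat.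
           (\<forall>i<n. item_dist (D i)) \<longrightarrow> frequent m n D \<longrightarrow> real m \<ge> c * ln (real n) \<longrightarrow>
           (\<exists>A. online_algorithm A \<and>
                random_order_value A n D \<ge> ennreal ((1 - \<epsilon>) * \<alpha>) * expected_max n D)"
proof -
  \<comment> \<open>The loss occurs twice, in the phase parameters and in the unbalanced orders, and
    \<open>(1 - \<epsilon>')^2 \<ge> 1 - \<epsilon>\<close>. The minimum keeps
    \<open>\<epsilon>'\<close> at most 1 when \<open>\<epsilon>\<close> is large.\<close>
  define \<epsilon>' where "\<epsilon>' = min \<epsilon> 1 / 2"
  have \<epsilon>': "0 < \<epsilon>'" "\<epsilon>' \<le> 1" "\<epsilon>' \<le> \<epsilon> / 2" using assms(5) by (auto simp: \<epsilon>'_def)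
  have "0 < cos a" using assms by (intro cos_gt_zero_pi) auto
  hence \<alpha>: "0 \<le> \<alpha>" "\<alpha> \<le> 1" using assms(4) by auto
  obtain K :: nat and \<delta> :: real where K: "2 \<le> K" "a * tan a \<le> K" and \<delta>: "0 < \<delta>" "\<delta> < 1" and
    \<beta>: "(1 - \<epsilon>') * (1 - cos a) \<le> (1 - \<delta>) * (1 - a * tan a / K) * exp (K * \<delta> * ln (cos a)) * (1 - cos a - exp (a * tan a) / K)"
      "(1 - \<epsilon>') * (1 - cos a) \<le> (1 - \<delta>) * (1 - cos a - a / K)"
    using exists_phase_parameters[OF assms(1,2) \<epsilon>'(1)] by (elim exE conjE)
  have \<beta>01: "0 \<le> (1 - \<epsilon>') * (1 - cos a)" "(1 - \<epsilon>') * (1 - cos a) \<le> 1"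
    using \<epsilon>' \<alpha> unfolding assms(4) by (auto intro!: mult_le_one mult_nonneg_nonneg)
  have \<gamma>: "0 < (\<delta> / K)\<^sup>2 / 16" using \<delta> K by simp
  have K1: "1 \<le> K" using K by simp
  have M: "0 \<le> 2 * real K / \<delta>" using \<delta> by simp
  obtain c where c: "\<forall>(n::nat) m. 2 \<le> n \<longrightarrow> c * ln (real n) \<le> m \<longrightarrow>
      2 * real K / \<delta> \<le> m \<and> real K * real n * exp (- ((\<delta> / K)\<^sup>2 / 16) * m) \<le> \<epsilon>'"
    using exists_frequency_constant[OF \<gamma> \<epsilon>'(1,2) K1 M] by (elim exE)
  have "(1 - \<epsilon>) * \<alpha> \<le> ((1 - \<epsilon>') * (1 - \<epsilon>')) * \<alpha>"
  proof (rule mult_right_mono)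
    have "(1 - \<epsilon>') * (1 - \<epsilon>') = 1 - 2 * \<epsilon>' + \<epsilon>' * \<epsilon>'" by (simp add: algebra_simps)
    thus "1 - \<epsilon> \<le> (1 - \<epsilon>') * (1 - \<epsilon>')" using \<epsilon>'(3) zero_le_square[of \<epsilon>'] by linarith
  qed (rule \<alpha>)
  hence loss: "(1 - \<epsilon>) * \<alpha> \<le> (1 - \<epsilon>') * ((1 - \<epsilon>') * (1 - cos a))" by (simp add: assms(4) mult.assoc)
  show ?thesis
  proof (intro exI[of _ c] allI impI)
    fix n :: nat and D :: "nat \<Rightarrow> real measure" and m :: nat
    assume n: "1 \<le> n" and D: "\<forall>i<n. item_dist (D i)" and freq: "frequent m n D" and m: "c * ln (real n) \<le> real m"
    show "\<exists>A. online_algorithm A \<and> ennreal ((1 - \<epsilon>) * \<alpha>) * expected_max n D \<le> random_order_value A n D"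
    proof (cases "n = 1")
      case True
      have "(1 - \<epsilon>) * \<alpha> \<le> 1 * 1" using \<alpha> assms(5) by (intro mult_mono) auto
      hence "ennreal ((1 - \<epsilon>) * \<alpha>) * expected_max n D \<le> 1 * expected_max n D"
        by (intro mult_right_mono) (auto simp: ennreal_le_1)
      also have "\<dots> \<le> random_order_value (\<lambda>_ _. True) n D" using single_item_value[of D] True by simp
      finally show ?thesis by (intro exI[of _ "\<lambda>_ _. True"]) (simp add: online_algorithm_def)
    next
      case False
      \<comment> \<open>Indices from \<open>n\<close> on are padded with \<open>D 0\<close> to
        obtain an item law everywhere; the product measure over \<open>{..<n}\<close> is
        unchanged.\<close>
      define D' where "D' i = (if i < n then D i else D 0)" for i
      interpret items n D'
        by unfold_locales (use n D in \<open>auto simp: D'_def\<close>)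
      have PiM: "Pi\<^sub>M {..<n} D' = Pi\<^sub>M {..<n} D" by (intro PiM_cong) (auto simp: D'_def)
      have law: "m \<le> card (same_law j)" if "j < n" for j
      proof -
        \<comment> \<open>The class contains \<open>j\<close> itself, which turns the bound
          \<open>m - 1\<close> on the other items into \<open>m\<close>.\<close>
        have eq: "same_law j = insert j {k. k < n \<and> k \<noteq> j \<and> cdf (D k) = cdf (D j)}"
          using that by (auto simp: same_law_def D'_def)
        have "m - 1 \<le> card {k. k < n \<and> k \<noteq> j \<and> cdf (D k) = cdf (D j)}"
          using freq that unfolding frequent_def by blast
        thus ?thesis unfolding eq by simp
      qed
      have mm: "2 * real K / \<delta> \<le> real m \<and> real K * real n * exp (- ((\<delta> / K)\<^sup>2 / 16) * real m) \<le> \<epsilon>'"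
        using c[rule_format, of n "real m"] n False m by simp
      obtain A where A: "online_algorithm A"
        "ennreal ((1 - \<epsilon>') * ((1 - \<epsilon>') * (1 - cos a))) * expected_max n D' \<le> random_order_value A n D'"
        using exists_threshold_algorithm[OF assms(1-3) less_imp_le[OF \<epsilon>'(1)] \<epsilon>'(2) K \<delta> \<beta>01 \<beta> law
          mm[THEN conjunct1] mm[THEN conjunct2]] by blast
      have "ennreal ((1 - \<epsilon>) * \<alpha>) * expected_max n D' \<le>
          ennreal ((1 - \<epsilon>') * ((1 - \<epsilon>') * (1 - cos a))) * expected_max n D'"
        using loss by (intro mult_right_mono ennreal_leI) auto
      also note A(2)
      finally have "ennreal ((1 - \<epsilon>) * \<alpha>) * expected_max n D' \<le> random_order_value A n D'" .
      thus ?thesis using A(1) unfolding expected_max_def random_order_value_def PiM by blast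
    qed
  qed
qed

end
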